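(* Let $\sigma^{**}(N)$ denote the sum of the biunitary divisors of a positive integer $N$. A positive integer $N$ satisfies $\sigma^{**}(\sigma^{**}(N))=2N$ if and only if $N=2$ or $N=9$.
   Context: A divisor $d$ of $N$ is a unitary divisor if $\gcd(d,N/d)=1$. A divisor $d$ of a positive integer $N$ is a biunitary divisor if the greatest common unitary divisor of $d$ and $N/d$ is $1$. $\sigma^{**}(N)$ is the sum of all biunitary divisors of $N$. Equivalently, $\sigma^{**}$ is multiplicative and for a prime $p$ and positive integer $e$: $\sigma^{**}(p^e)=\frac{p^{e+1}-1}{p-1}$ if $e$ is odd, and $\sigma^{**}(p^e)=\frac{p^{e+1}-1}{p-1}-p^{e/2}$ if $e$ is even. *)

theory Defs
  imports "HOL-Number_Theory.Number_Theory"
begin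

definition unitary_divisor :: "nat \<Rightarrow> nat \<Rightarrow> bool" where
  "unitary_divisor d n \<longleftrightarrow> d dvd n \<and> coprime d (n div d)"

text \<open>
  For positive \<open>a\<close> and \<open>b\<close> the set below is finite and contains 1, so \<open>Max\<close> is its greatest element.
\<close>

definition greatest_common_unitary_divisor :: "nat \<Rightarrow> nat \<Rightarrow> nat" where
  "greatest_common_unitary_divisor a b = Max {c. unitary_divisor c a \<and> unitary_divisor c b}"

definition biunitary_divisor :: "nat \<Rightarrow> nat \<Rightarrow> bool" where
  "biunitary_divisor d n \<longleftrightarrow> d dvd n \<and> greatest_common_unitary_divisor d (n div d) = 1"

definition biunitary_sigma :: "nat \<Rightarrow> nat" where
  "biunitary_sigma n = (\<Sum>d | biunitary_divisor d n. d)"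

end

theory Submission
  imports Defs
begin

text \<open>
  Write \<open>\<sigma>\<close> for the biunitary divisor sum and \<open>M = \<sigma> N\<close>, so that the indices \<open>\<sigma> N / N\<close> and \<open>\<sigma> M / M\<close>
  multiply to 2. For an odd prime \<open>p\<close> every \<open>\<sigma> (p^e)\<close> with \<open>e > 0\<close> is even. Hence if \<open>N\<close> is odd, then
  \<open>\<sigma> M = 2 N\<close> forces \<open>M = 2^f q^b\<close> with a single odd prime \<open>q\<close>. The odd number \<open>\<sigma> (2^f)\<close> divides \<open>N\<close>, and
  unless \<open>f \<le> 2\<close> its smallest prime factors make the index of \<open>N\<close> too large; the exception is that
  \<open>f = 2 k\<close> with \<open>p = 2^k - 1\<close> and \<open>r = 2^(k + 1) + 1\<close> both prime and \<open>p^2\<close> exactly dividing \<open>N\<close>. Then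
  \<open>(p^2 + 1) / 2\<close> is a power of \<open>q\<close>, which conflicts with \<open>\<sigma>\<close> of the power of \<open>r\<close> in \<open>N\<close>.
  If \<open>N\<close> is even and \<open>M\<close> is odd, then \<open>N\<close> is a power of 2 and the same dichotomy applies to \<open>M\<close>. If both are even,
  then the bound 2 for the product of the indices forces 4 and 25 to divide both exactly; so 13 divides
  both, 13 divides \<open>M\<close> only once, and then 7 divides \<open>N\<close>, which is impossible.
\<close>

section \<open>Biunitary divisors\<close>

text \<open>Coprimality of \<open>c\<close> and \<open>a div c\<close> leaves no factor
  \<open>p\<close> for the cofactor, so \<open>c\<close> carries the whole \<open>p\<close>-part of
  \<open>a\<close>.\<close>

lemma multiplicity_unitary_divisor:
  assumes "unitary_divisor c a" "a > 0" "prime p" "p dvd c"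
  shows "multiplicity p c = multiplicity p a"
proof -
  from assms have dv: "c dvd a" and cop: "coprime c (a div c)"
    by (auto simp: unitary_divisor_def)
  define y where "y = a div c"
  have a: "a = c * y" using dv by (simp add: y_def)
  have "\<not> p dvd y" using cop assms(3,4) coprime_common_divisor[of c y p]
    by (auto simp: y_def)
  moreover have "c \<noteq> 0" "y \<noteq> 0" using a \<open>a > 0\<close> by auto
  ultimately show ?thesis
    using assms(3) unfolding a
    by (subst prime_elem_multiplicity_mult_distrib) (auto simp: not_dvd_imp_multiplicity_0)
qed

lemma unitary_divisor_prime_power:
  assumes "a > 0" "prime (p :: nat)"
  shows "unitary_divisor (p ^ multiplicity p a) a"
proof -
  from assms obtain y where y: "a = p ^ multiplicity p a * y" "\<not> p dvd y"
    using multiplicity_decompose'[of a p] not_prime_unit by blast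
  have "coprime (p ^ multiplicity p a) y"
    using y(2) assms(2) by (simp add: prime_imp_coprime)
  moreover have "a div p ^ multiplicity p a = y"
    using assms y(1) by (metis nonzero_mult_div_cancel_left power_eq_0_iff not_prime_0)
  ultimately show ?thesis by (simp add: unitary_divisor_def multiplicity_dvd)
qed

text \<open>This trades \<open>Max\<close> for a condition at each prime: a prime with equal
  multiplicities yields the common unitary divisor \<open>p ^ multiplicity p a\<close>, and
  conversely each prime factor of a common unitary divisor has its full multiplicity in both
  numbers.\<close>

lemma greatest_common_unitary_divisor_eq_1_iff:
  assumes "a > 0" "b > 0"
  shows "greatest_common_unitary_divisor a b = 1 \<longleftrightarrow>
    \<not> (\<exists>p. prime p \<and> p dvd a \<and> multiplicity p a = multiplicity p b)"
proof -
  define S where "S = {c. unitary_divisor c a \<and> unitary_divisor c b}"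
  have fin: "finite S"
    by (rule finite_subset[of _ "{d. d dvd a}"]) (use assms in \<open>auto simp: S_def unitary_divisor_def\<close>)
  have one: "1 \<in> S" by (simp add: S_def unitary_divisor_def)
  have gc: "greatest_common_unitary_divisor a b = Max S"
    by (simp add: S_def greatest_common_unitary_divisor_def)
  show ?thesis
  proof
    assume max1: "greatest_common_unitary_divisor a b = 1"
    show "\<not> (\<exists>p. prime p \<and> p dvd a \<and> multiplicity p a = multiplicity p b)"
    proof
      assume "\<exists>p. prime p \<and> p dvd a \<and> multiplicity p a = multiplicity p b"
      then obtain p where p: "prime p" "p dvd a" "multiplicity p a = multiplicity p b" by auto
      have "p ^ multiplicity p a \<in> S"
        using unitary_divisor_prime_power[OF assms(1) p(1)]
          unitary_divisor_prime_power[OF assms(2) p(1), folded p(3)]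
        by (simp add: S_def)
      then have "p ^ multiplicity p a \<le> 1"
        using max1 gc fin Max_ge by metis
      moreover have "multiplicity p a > 0"
        using p(1,2) assms by (simp add: prime_multiplicity_gt_zero_iff)
      ultimately show False
        using p(1) prime_gt_1_nat one_less_power[of p "multiplicity p a"] by force
    qed
  next
    assume no: "\<not> (\<exists>p. prime p \<and> p dvd a \<and> multiplicity p a = multiplicity p b)"
    show "greatest_common_unitary_divisor a b = 1"
    proof (rule ccontr)
      assume "\<not> ?thesis"
      then have "Max S \<noteq> 1" by (simp add: gc)
      then obtain p where p: "prime p" "p dvd Max S" using prime_factor_nat by blast
      have "Max S \<in> S" using fin one Max_in by blast
      then have "multiplicity p (Max S) = multiplicity p a"
        "multiplicity p (Max S) = multiplicity p b" "Max S dvd a"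
        using multiplicity_unitary_divisor[of "Max S"] p assms
        by (auto simp: S_def unitary_divisor_def)
      then show False using no p dvd_trans by metis
    qed
  qed
qed

text \<open>Multiplicities in \<open>d\<close> and \<open>n div d\<close> add up to the one in
  \<open>n\<close>, so they agree exactly when the one in \<open>n\<close> is twice the one in
  \<open>d\<close>. All later facts about biunitary divisors go through this criterion.\<close>

lemma biunitary_divisor_iff:
  assumes "n > 0"
  shows "biunitary_divisor d n \<longleftrightarrow>
    d dvd n \<and> (\<forall>p. prime p \<longrightarrow> p dvd n \<longrightarrow> multiplicity p n \<noteq> 2 * multiplicity p d)"
proof (cases "d dvd n")
  case True
  define y where "y = n div d"
  have n: "n = d * y" using True by (simp add: y_def)
  have pos: "d > 0" "y > 0" using n assms by (auto intro!: Nat.gr0I)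
  have mul: "multiplicity p n = multiplicity p d + multiplicity p y" if "prime p" for p
    using that pos unfolding n by (intro prime_elem_multiplicity_mult_distrib) auto
  have "(\<exists>p. prime p \<and> p dvd d \<and> multiplicity p d = multiplicity p y) \<longleftrightarrow>
        (\<exists>p. prime p \<and> p dvd n \<and> multiplicity p n = 2 * multiplicity p d)"
  proof (rule ex_cong1, rule conj_cong, rule refl)
    fix p :: nat assume p: "prime p"
    have "p dvd d" if "p dvd n" "multiplicity p n = 2 * multiplicity p d"
    proof -
      have "multiplicity p n > 0" using that(1) p assms by (simp add: prime_multiplicity_gt_zero_iff)
      then have "multiplicity p d > 0" using that(2) by linarith
      then show ?thesis using p pos by (simp add: prime_multiplicity_gt_zero_iff)
    qed
    then show "(p dvd d \<and> multiplicity p d = multiplicity p y) \<longleftrightarrow>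
          (p dvd n \<and> multiplicity p n = 2 * multiplicity p d)"
      using mul[OF p] n by auto
  qed
  then show ?thesis
    using True greatest_common_unitary_divisor_eq_1_iff[OF pos]
    by (auto simp: biunitary_divisor_def y_def)
qed (simp add: biunitary_divisor_def)

section \<open>Multiplicativity of the divisor sum and its values at prime powers\<close>

lemma finite_biunitary_divisors: "n > 0 \<Longrightarrow> finite {d. biunitary_divisor d n}"
  by (rule finite_subset[of _ "{d. d dvd n}"]) (auto simp: biunitary_divisor_def)

lemma biunitary_divisor_self: "n > 0 \<Longrightarrow> biunitary_divisor n n"
  by (auto simp: biunitary_divisor_iff prime_multiplicity_gt_zero_iff)

lemma biunitary_sigma_ge: "n > 0 \<Longrightarrow> biunitary_sigma n \<ge> n"
  unfolding biunitary_sigma_def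
  using member_le_sum[of n "{d. biunitary_divisor d n}" "\<lambda>d. d"]
  by (auto simp: biunitary_divisor_self finite_biunitary_divisors)

text \<open>The criterion is tested prime by prime, and each prime dividing \<open>a * b\<close>
  sees only one of the coprime factors.\<close>

lemma biunitary_divisor_mult_iff:
  assumes cop: "coprime a b" and "a > 0" "b > 0" and "x dvd a" "y dvd b"
  shows "biunitary_divisor (x * y) (a * b) \<longleftrightarrow> biunitary_divisor x a \<and> biunitary_divisor y b"
proof -
  have pos: "x > 0" "y > 0" using assms by (auto intro!: Nat.gr0I)
  have ma: "multiplicity p (a * b) = multiplicity p a" "multiplicity p (x * y) = multiplicity p x"
    if "prime p" "p dvd a" for p
  proof -
    have "\<not> p dvd b" using cop that coprime_common_divisor[of a b p] by auto
    moreover then have "\<not> p dvd y" using \<open>y dvd b\<close> dvd_trans by blast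
    ultimately show "multiplicity p (a * b) = multiplicity p a"
      "multiplicity p (x * y) = multiplicity p x"
      using that pos assms
      by (simp_all add: prime_elem_multiplicity_mult_distrib not_dvd_imp_multiplicity_0)
  qed
  have mb: "multiplicity p (a * b) = multiplicity p b" "multiplicity p (x * y) = multiplicity p y"
    if "prime p" "p dvd b" for p
  proof -
    have "\<not> p dvd a" using cop that coprime_common_divisor[of a b p] by auto
    moreover then have "\<not> p dvd x" using \<open>x dvd a\<close> dvd_trans by blast
    ultimately show "multiplicity p (a * b) = multiplicity p b"
      "multiplicity p (x * y) = multiplicity p y"
      using that pos assms
      by (simp_all add: prime_elem_multiplicity_mult_distrib not_dvd_imp_multiplicity_0)
  qed
  have "x * y dvd a * b" using assms by (simp add: mult_dvd_mono)
  then show ?thesis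
    using assms ma mb by (auto simp: biunitary_divisor_iff prime_dvd_mult_iff)
qed

lemma biunitary_sigma_mult:
  assumes cop: "coprime a b" and pos: "a > 0" "b > 0"
  shows "biunitary_sigma (a * b) = biunitary_sigma a * biunitary_sigma b"
proof -
  let ?B = "\<lambda>n. {d. biunitary_divisor d n}"
  let ?f = "\<lambda>(x, y). x * y :: nat"
  have inj: "inj_on ?f (?B a \<times> ?B b)"
  proof (rule inj_onI, clarsimp)
    fix x y x' y' assume B: "biunitary_divisor x a" "biunitary_divisor y b"
      "biunitary_divisor x' a" "biunitary_divisor y' b" and eq: "x * y = x' * y'"
    then have dv: "x dvd a" "y dvd b" "x' dvd a" "y' dvd b" by (auto simp: biunitary_divisor_def)
    have "coprime x y'" "coprime x' y"
      using dv cop by (meson coprime_divisors)+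
    moreover have "x dvd x' * y'" "x' dvd x * y" using eq by (metis dvd_triv_left)+
    ultimately have "x dvd x'" "x' dvd x" by (simp_all add: coprime_dvd_mult_left_iff)
    then have "x = x'" by (rule dvd_antisym)
    moreover have "x > 0" using dv pos by (auto intro!: Nat.gr0I)
    ultimately show "x = x' \<and> y = y'" using eq by simp
  qed
  have im: "?B (a * b) = ?f ` (?B a \<times> ?B b)"
  proof (intro equalityI subsetI)
    fix d assume "d \<in> ?B (a * b)"
    then have B: "biunitary_divisor d (a * b)" by simp
    then have "d dvd a * b" by (simp add: biunitary_divisor_def)
    then obtain x y where xy: "d = x * y" "x dvd a" "y dvd b" using division_decomp by metis
    then have "(x, y) \<in> ?B a \<times> ?B b" using B biunitary_divisor_mult_iff[OF cop pos xy(2,3)] by auto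
    then show "d \<in> ?f ` (?B a \<times> ?B b)" using xy(1) by force
  next
    fix d assume "d \<in> ?f ` (?B a \<times> ?B b)"
    then obtain x y where xy: "d = x * y" "biunitary_divisor x a" "biunitary_divisor y b" by auto
    then have "x dvd a" "y dvd b" by (auto simp: biunitary_divisor_def)
    then show "d \<in> ?B (a * b)" using xy biunitary_divisor_mult_iff[OF cop pos] by simp
  qed
  show ?thesis
    unfolding biunitary_sigma_def im
    by (subst sum.reindex[OF inj]) (simp add: sum_product sum.cartesian_product case_prod_beta)
qed

lemma biunitary_sigma_prime_power:
  assumes p: "prime p" and e: "e > 0"
  shows "biunitary_sigma (p ^ e) = (\<Sum>i | i \<le> e \<and> 2 * i \<noteq> e. p ^ i)"
proof -
  have p1: "p > 1" using p prime_gt_1_nat by blast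
  have "{d. biunitary_divisor d (p ^ e)} = (\<lambda>i. p ^ i) ` {i. i \<le> e \<and> 2 * i \<noteq> e}"
  proof (intro equalityI subsetI)
    fix d assume "d \<in> {d. biunitary_divisor d (p ^ e)}"
    then have B: "biunitary_divisor d (p ^ e)" by simp
    then obtain i where i: "i \<le> e" "d = p ^ i"
      using p by (auto simp: biunitary_divisor_def divides_primepow_nat)
    moreover have "e \<noteq> 2 * i"
      using B p p1 e i(2) by (auto simp: biunitary_divisor_iff)
    ultimately show "d \<in> (\<lambda>i. p ^ i) ` {i. i \<le> e \<and> 2 * i \<noteq> e}" by auto
  next
    fix d assume "d \<in> (\<lambda>i. p ^ i) ` {i. i \<le> e \<and> 2 * i \<noteq> e}"
    then obtain i where i: "i \<le> e" "2 * i \<noteq> e" "d = p ^ i" by auto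
    have "multiplicity q (p ^ e) \<noteq> 2 * multiplicity q (p ^ i)" if "prime q" "q dvd p ^ e" for q
    proof -
      have "q dvd p" using that prime_dvd_power by blast
      then have "q = p" using that(1) p by (rule primes_dvd_imp_eq[rotated 2])
      then show ?thesis using i(2) p p1 by simp
    qed
    then show "d \<in> {d. biunitary_divisor d (p ^ e)}"
      using i p1 by (simp add: biunitary_divisor_iff le_imp_power_dvd)
  qed
  moreover have "inj_on (\<lambda>i. p ^ i) {i. i \<le> e \<and> 2 * i \<noteq> e}"
    using p1 by (auto simp: inj_on_def)
  ultimately show ?thesis unfolding biunitary_sigma_def by (simp add: sum.reindex)
qed

lemma biunitary_sigma_1: "biunitary_sigma 1 = 1"
proof -
  have "{d. biunitary_divisor d 1} = {1}"
    by (auto simp: biunitary_divisor_iff)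
  then show ?thesis by (simp add: biunitary_sigma_def)
qed

section \<open>Prime powers\<close>

text \<open>Pairing consecutive powers exposes the factor \<open>1 + p\<close> of a geometric sum
  with an even number of terms.\<close>

lemma sum_powers_even:
  fixes p :: nat
  shows "(\<Sum>i<2 * m. p ^ i) = (1 + p) * (\<Sum>i<m. p ^ (2 * i))"
proof (induction m)
  case (Suc m)
  have "(\<Sum>i<2 * Suc m. p ^ i) = (\<Sum>i<2 * m. p ^ i) + p ^ (2 * m) + p ^ (2 * m + 1)" by simp
  also have "\<dots> = (1 + p) * (\<Sum>i<m. p ^ (2 * i)) + p ^ (2 * m) + p * p ^ (2 * m)"
    using Suc.IH by simp
  also have "\<dots> = (1 + p) * (\<Sum>i<Suc m. p ^ (2 * i))" by (simp add: distrib_left distrib_right)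
  finally show ?case .
qed simp

lemma biunitary_sigma_prime_power_odd:
  assumes "prime p"
  shows "biunitary_sigma (p ^ (2 * m + 1)) = (\<Sum>i<2 * (m + 1). p ^ i)"
proof -
  have "{i. i \<le> 2 * m + 1 \<and> 2 * i \<noteq> 2 * m + 1} = {..<2 * (m + 1)}"
  proof -
    have "2 * i \<noteq> 2 * m + 1" for i by presburger
    then show ?thesis by auto
  qed
  then show ?thesis using biunitary_sigma_prime_power[OF assms, of "2 * m + 1"] by simp
qed

text \<open>Removing the middle exponent \<open>k\<close> leaves the exponents below
  \<open>k\<close> and their translates by \<open>k + 1\<close>, which is why the sum
  factors.\<close>

lemma biunitary_sigma_prime_power_even:
  assumes "prime p" "k > 0"
  shows "biunitary_sigma (p ^ (2 * k)) = (\<Sum>i<k. p ^ i) * (p ^ (k + 1) + 1)"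
proof -
  have eq: "{i. i \<le> 2 * k \<and> 2 * i \<noteq> 2 * k} = {..<k} \<union> (\<lambda>i. i + (k + 1)) ` {..<k}"
  proof (intro equalityI subsetI)
    fix i assume i: "i \<in> {i. i \<le> 2 * k \<and> 2 * i \<noteq> 2 * k}"
    show "i \<in> {..<k} \<union> (\<lambda>i. i + (k + 1)) ` {..<k}"
    proof (cases "i < k")
      case False
      then have "i = (i - (k + 1)) + (k + 1)" "i - (k + 1) < k" using i by auto
      then show ?thesis by blast
    qed simp
  qed auto
  have "biunitary_sigma (p ^ (2 * k)) = (\<Sum>i\<in>{..<k} \<union> (\<lambda>i. i + (k + 1)) ` {..<k}. p ^ i)"
    using biunitary_sigma_prime_power[OF assms(1), of "2 * k"] assms(2) by (simp only: eq)
  also have "\<dots> = (\<Sum>i<k. p ^ i) + (\<Sum>i\<in>(\<lambda>i. i + (k + 1)) ` {..<k}. p ^ i)"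
    by (rule sum.union_disjoint) auto
  also have "(\<Sum>i\<in>(\<lambda>i. i + (k + 1)) ` {..<k}. p ^ i) = (\<Sum>i<k. p ^ i * p ^ (k + 1))"
    by (subst sum.reindex) (auto simp: inj_on_def power_add algebra_simps)
  also have "\<dots> = (\<Sum>i<k. p ^ i) * p ^ (k + 1)" by (simp add: sum_distrib_right)
  finally show ?thesis by (simp add: algebra_simps)
qed

lemma biunitary_sigma_prime:
  assumes "prime p"
  shows "biunitary_sigma p = p + 1"
  using biunitary_sigma_prime_power_odd[OF assms, of 0] by (simp add: numeral_2_eq_2)

lemma biunitary_sigma_prime_square:
  assumes "prime p"
  shows "biunitary_sigma (p ^ 2) = p ^ 2 + 1"
  using biunitary_sigma_prime_power_even[OF assms, of 1]
  by (simp add: power2_eq_square)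

lemma exponent_cases:
  fixes e :: nat
  assumes "e > 0"
  obtains (odd) m where "e = 2 * m + 1"
    | (even) m where "e = 2 * (2 * m)" "m > 0"
    | (two) "e = 2"
    | (twice_odd) m where "e = 2 * (2 * m + 1)" "m > 0"
proof -
  consider m where "e = 2 * m + 1" | m where "e = 2 * (2 * m)" | m where "e = 2 * (2 * m + 1)"
    by (metis evenE oddE)
  then show ?thesis
  proof cases
    case (2 m) then show ?thesis using that(2)[of m] assms by simp
  next
    case (3 m) then show ?thesis using that(3) that(4)[of m] by (cases "m = 0") auto
  qed (use that in auto)
qed

text \<open>For odd \<open>e\<close> the whole sum, and for \<open>e\<close> divisible by 4 its
  first factor, is a geometric sum with an even number of terms.\<close>

lemma Suc_dvd_biunitary_sigma:
  assumes p: "prime p" and "e > 0" and "\<not> (\<exists>m. e = 2 * (2 * m + 1))"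
  shows "p + 1 dvd biunitary_sigma (p ^ e)"
  using assms(2)
proof (cases rule: exponent_cases)
  case (odd m)
  then show ?thesis
    using biunitary_sigma_prime_power_odd[OF p, of m] sum_powers_even[of p "m + 1"]
    by (metis dvd_triv_left add.commute)
next
  case (even m)
  then show ?thesis
    using biunitary_sigma_prime_power_even[OF p, of "2 * m"] sum_powers_even[of p m]
    by (metis dvd_triv_left dvd_mult2 add.commute nat_0_less_mult_iff zero_less_numeral)
next
  case two
  then have "e = 2 * (2 * 0 + 1)" by simp
  then show ?thesis using assms(3) by blast
next
  case (twice_odd m)
  then show ?thesis using assms(3) by blast
qed

lemma even_biunitary_sigma_prime_power:
  assumes p: "prime p" "odd p" and "e > 0"
  shows "even (biunitary_sigma (p ^ e))"
proof (cases "\<exists>m. e = 2 * (2 * m + 1)")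
  case True
  then obtain m where "e = 2 * (2 * m + 1)" by blast
  then show ?thesis using biunitary_sigma_prime_power_even[OF p(1), of "2 * m + 1"] p(2) by simp
next
  case False
  then have "p + 1 dvd biunitary_sigma (p ^ e)" using Suc_dvd_biunitary_sigma[OF p(1) assms(3)] by blast
  then show ?thesis using p(2) by (meson dvd_trans odd_even_add odd_one)
qed

lemma odd_biunitary_sigma_power_of_2: "odd (biunitary_sigma (2 ^ e))"
proof (cases "e = 0")
  case True then show ?thesis by (metis biunitary_sigma_1 odd_one power_0)
next
  case False
  have odd_sum: "odd (\<Sum>i<k. 2 ^ i :: nat)" if "k > 0" for k
    using that by (cases k)
      (simp_all add: sum.lessThan_Suc_shift dvd_sum del: sum.lessThan_Suc)
  show ?thesis
  proof (cases "even e")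
    case True
    then obtain k where "e = 2 * k" by blast
    then show ?thesis
      using biunitary_sigma_prime_power_even[OF two_is_prime_nat, of k] odd_sum[of k] False by simp
  next
    case odd: False
    then obtain m where "e = 2 * m + 1" using oddE by blast
    then show ?thesis
      using biunitary_sigma_prime_power_odd[OF two_is_prime_nat, of m] odd_sum[of "2 * (m + 1)"] by simp
  qed
qed

text \<open>
  The primes come from the odd parts of the two factors \<open>(p^k - 1) / (p - 1)\<close> and \<open>p^(k + 1) + 1\<close>,
  which are coprime: modulo a common prime \<open>p\<close> would be -1, and then \<open>p^k - 1\<close> would be -2.
\<close>

lemma biunitary_sigma_twice_odd_exponent:
  assumes p: "prime p" "odd p" and "m > 0"
  obtains q r where "prime q" "prime r" "odd q" "odd r" "q \<noteq> r"
    "q * r dvd biunitary_sigma (p ^ (2 * (2 * m + 1)))"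
proof -
  define k where "k = 2 * m + 1"
  define u where "u = (\<Sum>i<k. p ^ i)"
  define w where "w = (p ^ (k + 1) + 1) div 2"
  have p3: "p \<ge> 3" using p prime_ge_2_nat[of p] by (cases "p = 2") auto
  have s: "biunitary_sigma (p ^ (2 * (2 * m + 1))) = u * (p ^ (k + 1) + 1)"
    using biunitary_sigma_prime_power_even[OF p(1), of k] by (simp add: u_def k_def)
  have "even (p ^ (k + 1) + 1)" using p by simp
  then have w: "2 * w = p ^ (k + 1) + 1" by (simp add: w_def)
  \<comment> \<open>As \<open>k + 1\<close> is even, \<open>p ^ (k + 1)\<close> is an odd square, so
    it is 1 modulo 4 and \<open>w\<close> is odd.\<close>
  have "p ^ (k + 1) = (p ^ (m + 1)) ^ 2" 
    by (simp add: k_def power2_eq_square flip: power_add) (simp add: mult_2)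
  moreover have "(p ^ (m + 1)) ^ 2 mod 4 = 1"
  proof -
    have "odd (p ^ (m + 1))" using p by simp
    then obtain j where "p ^ (m + 1) = 2 * j + 1" using oddE by blast
    then have "(p ^ (m + 1)) ^ 2 = 4 * (j ^ 2 + j) + 1" by (simp add: power2_eq_square algebra_simps)
    then show ?thesis by presburger
  qed
  ultimately have "odd w" using w by presburger
  have "p ^ (k + 1) \<ge> p ^ 1" by (rule power_increasing) (use p3 in auto)
  then have "p ^ (k + 1) \<ge> 3" using p3 by (metis le_trans power_one_right)
  then have "w > 1" using w p3 by linarith
  have "odd u" unfolding u_def k_def using p by (simp add: even_sum_iff)
  have "u \<ge> (\<Sum>i<3. p ^ i)" unfolding u_def
    by (rule sum_mono2) (use \<open>m > 0\<close> in \<open>auto simp: k_def\<close>)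
  then have "u > 1" using p3 by (simp add: eval_nat_numeral)
  obtain q where q: "prime q" "q dvd u" using \<open>u > 1\<close> prime_factor_nat[of u] by auto
  obtain r where r: "prime r" "r dvd w" using \<open>w > 1\<close> prime_factor_nat[of w] by auto
  have odds: "odd q" "odd r" using q r \<open>odd u\<close> \<open>odd w\<close> dvd_trans by blast+
  have "q \<noteq> r"
  proof
    assume "q = r"
    have "int q dvd int u" using q by simp
    moreover have "(int p - 1) * int u = int p ^ k - 1"
      by (simp add: u_def power_diff_1_eq)
    ultimately have d1: "int q dvd int p ^ k - 1" by (metis dvd_mult)
    have "q dvd p ^ (k + 1) + 1" using r(2) \<open>q = r\<close> unfolding w[symmetric] by simp
    then have "int q dvd int (p ^ (k + 1) + 1)" by (simp only: of_nat_dvd_iff)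
    then have d2: "int q dvd int p ^ (k + 1) + 1" by (simp add: add.commute)
    have "int q dvd (int p ^ (k + 1) + 1) - int p * (int p ^ k - 1)"
      using d2 dvd_mult[OF d1] by (rule dvd_diff)
    then have d3: "int q dvd int p + 1" by (simp add: algebra_simps)
    have "[int p = - 1] (mod int q)" using d3 by (simp add: cong_iff_dvd_diff)
    then have "[int p ^ k = (- 1) ^ k] (mod int q)" by (rule cong_pow)
    then have "int q dvd int p ^ k + 1" by (simp add: cong_iff_dvd_diff k_def)
    then have "int q dvd (int p ^ k + 1) - (int p ^ k - 1)" using d1 by (rule dvd_diff)
    then have "int q dvd 2" by simp
    then have "int q dvd int 2" by simp
    then have "q dvd 2" by (simp only: of_nat_dvd_iff)
    then have "q \<le> 2" by (simp add: dvd_imp_le)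
    then have "q = 2" using prime_ge_2_nat[OF q(1)] by simp
    then show False using odds by simp
  qed
  moreover have "q * r dvd u * (p ^ (k + 1) + 1)"
    unfolding w[symmetric] using q(2) r(2) by (intro mult_dvd_mono dvd_mult)
  ultimately show ?thesis using that q r odds s by metis
qed

text \<open>Exponent 0 is never the excluded middle one, so the sum is 1 modulo
  \<open>p\<close>.\<close>

lemma not_dvd_biunitary_sigma_prime_power:
  assumes p: "prime p" and "e > 0"
  shows "\<not> p dvd biunitary_sigma (p ^ e)"
proof -
  let ?I = "{i. i \<le> e \<and> 2 * i \<noteq> e}"
  have "biunitary_sigma (p ^ e) = 1 + (\<Sum>i\<in>?I - {0}. p ^ i)"
    using biunitary_sigma_prime_power[OF assms] assms(2) sum.remove[of ?I 0 "\<lambda>i. p ^ i"] by simp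
  moreover have "p dvd (\<Sum>i\<in>?I - {0}. p ^ i)" by (rule dvd_sum) auto
  ultimately show ?thesis using p not_prime_unit by (simp only: dvd_add_left_iff) blast
qed

section \<open>Splitting off one prime, and parity for odd numbers\<close>

lemma prime_power_split:
  assumes n: "n > (0 :: nat)" and p: "prime p" "p dvd n"
  obtains y where "n = p ^ multiplicity p n * y" "y > 0" "\<not> p dvd y" "multiplicity p n > 0"
    "coprime (p ^ multiplicity p n) y"
    "biunitary_sigma n = biunitary_sigma (p ^ multiplicity p n) * biunitary_sigma y"
proof -
  from assms obtain y where y: "n = p ^ multiplicity p n * y" "\<not> p dvd y"
    using multiplicity_decompose'[of n p] not_prime_unit by blast
  have cop: "coprime (p ^ multiplicity p n) y"
    using y(2) p by (simp add: prime_imp_coprime)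
  have "y > 0" using y n by (auto intro!: Nat.gr0I)
  moreover have "multiplicity p n > 0" using n p by (simp add: prime_multiplicity_gt_zero_iff)
  moreover have "biunitary_sigma n = biunitary_sigma (p ^ multiplicity p n) * biunitary_sigma y"
    using biunitary_sigma_mult[OF cop] \<open>y > 0\<close> p y(1) by (metis prime_gt_0_nat zero_less_power)
  ultimately show ?thesis using that y cop by blast
qed

lemma biunitary_sigma_prime_power_dvd:
  assumes "n > 0" "prime p" "p dvd n"
  shows "biunitary_sigma (p ^ multiplicity p n) dvd biunitary_sigma n"
  using prime_power_split[OF assms] by (metis dvd_triv_left)

lemma even_biunitary_sigma:
  assumes "odd n" "n > 1"
  shows "even (biunitary_sigma n)"
proof -
  obtain p where p: "prime p" "p dvd n" using assms prime_factor_nat[of n] by auto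
  then have "odd p" using assms dvd_trans by blast
  then show ?thesis
    using biunitary_sigma_prime_power_dvd[of n p] even_biunitary_sigma_prime_power[of p "multiplicity p n"]
      p assms by (metis dvd_trans gr0I not_one_less_zero prime_multiplicity_gt_zero_iff
        prime_imp_prime_elem less_trans zero_less_one neq0_conv)
qed

text \<open>Every odd prime of \<open>n\<close> contributes an even factor to the divisor sum, so
  two different primes would already give a factor 4.\<close>

lemma prime_power_of_not_4_dvd_biunitary_sigma:
  assumes "odd n" "n > 1" and n4: "\<not> 4 dvd biunitary_sigma n"
  obtains p e where "prime p" "odd p" "e > 0" "n = p ^ e"
proof -
  obtain p where p: "prime p" "p dvd n" using assms prime_factor_nat[of n] by auto
  have op: "odd p" using p assms dvd_trans by blast
  have "n > 0" using assms by simp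
  from prime_power_split[OF this p] obtain y where y:
    "n = p ^ multiplicity p n * y" "y > 0" "multiplicity p n > 0"
    "biunitary_sigma n = biunitary_sigma (p ^ multiplicity p n) * biunitary_sigma y" by metis
  have ev: "even (biunitary_sigma (p ^ multiplicity p n))"
    using even_biunitary_sigma_prime_power p op y(3) by blast
  have "odd y" using y(1) assms(1) by (metis dvd_mult)
  have "y = 1"
  proof (rule ccontr)
    assume "y \<noteq> 1"
    then have "even (biunitary_sigma y)" using even_biunitary_sigma[of y] y(2) \<open>odd y\<close> by simp
    then have "2 * 2 dvd biunitary_sigma n" unfolding y(4) using ev mult_dvd_mono by blast
    then show False using n4 by simp
  qed
  then show ?thesis using that p(1) op y(1,3) by (metis mult.right_neutral)
qed

section \<open>The index of a number\<close>

text \<open>The biunitary analogue of the abundancy index.\<close>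

definition biunitary_index :: "nat \<Rightarrow> real" where
  "biunitary_index n = real (biunitary_sigma n) / real n"

lemma biunitary_index_nonneg [simp]: "biunitary_index n \<ge> 0"
  by (simp add: biunitary_index_def)

lemma biunitary_index_mult:
  "coprime a b \<Longrightarrow> a > 0 \<Longrightarrow> b > 0 \<Longrightarrow>
    biunitary_index (a * b) = biunitary_index a * biunitary_index b"
  by (simp add: biunitary_index_def biunitary_sigma_mult)

lemma biunitary_index_ge_1: "n > 0 \<Longrightarrow> biunitary_index n \<ge> 1"
  using biunitary_sigma_ge[of n] by (simp add: biunitary_index_def)

text \<open>All indices are at least 1, so discarding the primes outside \<open>P\<close> only
  lowers the product; a prime in \<open>P\<close> that does not divide \<open>n\<close> contributes
  1.\<close>

lemma biunitary_index_ge_prod: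
  assumes "finite P" "\<forall>p\<in>P. prime p" "n > 0"
  shows "(\<Prod>p\<in>P. biunitary_index (p ^ multiplicity p n)) \<le> biunitary_index n"
  using assms
proof (induction P arbitrary: n rule: finite_induct)
  case empty
  then show ?case by (simp add: biunitary_index_ge_1)
next
  case (insert p P)
  have p: "prime p" using insert.prems by simp
  obtain y where y: "n = p ^ multiplicity p n * y" "\<not> p dvd y"
    using multiplicity_decompose'[of n p] not_prime_unit p insert.prems by blast
  have "y > 0" using y insert.prems by (auto intro!: Nat.gr0I)
  have pp: "p ^ multiplicity p n > 0" using p prime_gt_0_nat by simp
  have "multiplicity q n = multiplicity q y" if "q \<in> P" for q
  proof -
    have q: "prime q" "q \<noteq> p" using that insert by auto
    then have "\<not> q dvd p ^ multiplicity p n" using p prime_dvd_power primes_dvd_imp_eq by blast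
    then show ?thesis
      using q p pp \<open>y > 0\<close> by (subst y(1), subst prime_elem_multiplicity_mult_distrib)
        (auto simp: not_dvd_imp_multiplicity_0)
  qed
  then have "(\<Prod>q\<in>P. biunitary_index (q ^ multiplicity q n)) =
      (\<Prod>q\<in>P. biunitary_index (q ^ multiplicity q y))" by simp
  also have "\<dots> \<le> biunitary_index y" using insert.IH[OF _ \<open>y > 0\<close>] insert.prems by simp
  finally have "(\<Prod>q\<in>P. biunitary_index (q ^ multiplicity q n)) \<le> biunitary_index y" .
  moreover have "biunitary_index n = biunitary_index (p ^ multiplicity p n) * biunitary_index y"
    using biunitary_index_mult[OF _ pp \<open>y > 0\<close>] y p prime_imp_coprime by (metis coprime_power_left_iff)
  ultimately show ?case
    using insert.hyps biunitary_index_ge_1[OF pp] by (simp add: mult_left_mono)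
qed

lemma biunitary_index_ge_prime_power:
  "prime p \<Longrightarrow> n > 0 \<Longrightarrow> biunitary_index (p ^ multiplicity p n) \<le> biunitary_index n"
  using biunitary_index_ge_prod[of "{p}" n] by simp

section \<open>Bounds for the index of a prime power\<close>

lemma sum_le_biunitary_sigma_prime_power:
  assumes "prime p" "e > 0" "I \<subseteq> {i. i \<le> e \<and> 2 * i \<noteq> e}"
  shows "(\<Sum>i\<in>I. p ^ i) \<le> biunitary_sigma (p ^ e)"
  unfolding biunitary_sigma_prime_power[OF assms(1,2)] by (rule sum_mono2) (use assms in auto)

text \<open>Only the exponents \<open>e\<close> and \<open>e - 1\<close> are kept;
  \<open>e - 1\<close> is the excluded middle exponent just for \<open>e = 2\<close>.\<close>

lemma biunitary_index_prime_power_ge: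
  assumes p: "prime p" and "e > 0" "e \<noteq> 2"
  shows "biunitary_index (p ^ e) \<ge> 1 + 1 / real p"
proof -
  have p0: "p > 0" using p prime_gt_0_nat by simp
  obtain d where e: "e = Suc d" using assms(2) gr0_implies_Suc by blast
  have "(\<Sum>i\<in>{e, d}. p ^ i) \<le> biunitary_sigma (p ^ e)"
    by (rule sum_le_biunitary_sigma_prime_power) (use assms e in auto)
  then have "p ^ e + p ^ d \<le> biunitary_sigma (p ^ e)" by (simp add: e)
  then have le: "real (p ^ e + p ^ d) \<le> real (biunitary_sigma (p ^ e))" by (simp only: of_nat_le_iff)
  have "1 + 1 / real p = real (p ^ e + p ^ d) / real (p ^ e)"
    using p0 by (simp add: e field_simps)
  also have "\<dots> \<le> biunitary_index (p ^ e)"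
    unfolding biunitary_index_def by (rule divide_right_mono[OF le]) simp
  finally show ?thesis .
qed

text \<open>The extra divisor 1 makes the two-term bound strict.\<close>

lemma biunitary_index_prime_power_gt:
  assumes p: "prime p" and "e \<ge> 3"
  shows "biunitary_index (p ^ e) > 1 + 1 / real p"
proof -
  have p0: "p > 0" using p prime_gt_0_nat by simp
  obtain d where e: "e = Suc d" using assms(2) by (cases e) auto
  have "(\<Sum>i\<in>{e, d, 0}. p ^ i) \<le> biunitary_sigma (p ^ e)"
    by (rule sum_le_biunitary_sigma_prime_power) (use assms e in auto)
  then have "p ^ e + p ^ d < biunitary_sigma (p ^ e)" using assms(2) by (simp add: e)
  then have le: "real (p ^ e + p ^ d) < real (biunitary_sigma (p ^ e))" by (simp only: of_nat_less_iff)
  have "1 + 1 / real p = real (p ^ e + p ^ d) / real (p ^ e)"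
    using p0 by (simp add: e field_simps)
  also have "\<dots> < biunitary_index (p ^ e)"
    unfolding biunitary_index_def by (rule divide_strict_right_mono[OF le]) (use p0 in simp)
  finally show ?thesis .
qed

text \<open>From \<open>e = 5\<close> on, a middle exponent lies below the top three exponents, so
  these can be kept.\<close>

lemma biunitary_index_prime_power_ge_5:
  assumes p: "prime p" and "e \<ge> 5"
  shows "biunitary_index (p ^ e) \<ge> 1 + 1 / real p + 1 / real p ^ 2"
proof -
  have p0: "p > 0" using p prime_gt_0_nat by simp
  define d where "d = e - 2"
  have e: "e = Suc (Suc d)" and "d \<ge> 3" using assms(2) by (auto simp: d_def)
  have "(\<Sum>i\<in>{e, Suc d, d}. p ^ i) \<le> biunitary_sigma (p ^ e)"
    by (rule sum_le_biunitary_sigma_prime_power) (use p e \<open>d \<ge> 3\<close> in auto)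
  then have "p ^ e + p ^ Suc d + p ^ d \<le> biunitary_sigma (p ^ e)" by (simp add: e)
  then have le: "real (p ^ e + p ^ Suc d + p ^ d) \<le> real (biunitary_sigma (p ^ e))"
    by (simp only: of_nat_le_iff)
  have "1 + 1 / real p + 1 / real p ^ 2 = real (p ^ e + p ^ Suc d + p ^ d) / real (p ^ e)"
    using p0 by (simp add: e field_simps power2_eq_square)
  also have "\<dots> \<le> biunitary_index (p ^ e)"
    unfolding biunitary_index_def by (rule divide_right_mono[OF le]) simp
  finally show ?thesis .
qed

text \<open>The exponent 2 is the worst case and gives equality.\<close>

lemma biunitary_index_prime_power_ge_square:
  assumes p: "prime p" and "e > 0"
  shows "biunitary_index (p ^ e) \<ge> 1 + 1 / real p ^ 2"
proof (cases "e = 2")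
  case True
  then show ?thesis
    using biunitary_sigma_prime_square[OF p] prime_gt_0_nat[OF p]
    by (simp add: biunitary_index_def field_simps)
next
  case False
  have "real p ^ 2 \<ge> real p" using prime_gt_0_nat[OF p] by (simp add: power2_eq_square)
  then have "1 / real p ^ 2 \<le> 1 / real p" using prime_gt_0_nat[OF p] by (simp add: frac_le)
  then show ?thesis using biunitary_index_prime_power_ge[OF assms False] by simp
qed

text \<open>Comparison with the full geometric sum, middle term included.\<close>

lemma biunitary_index_prime_power_less:
  assumes p: "prime p" and e: "e > 0"
  shows "biunitary_index (p ^ e) < real p / (real p - 1)"
proof -
  have p1: "p > 1" using p prime_gt_1_nat by simp
  have "biunitary_sigma (p ^ e) \<le> (\<Sum>i<e + 1. p ^ i)"
    unfolding biunitary_sigma_prime_power[OF assms] by (rule sum_mono2) auto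
  then have "real (biunitary_sigma (p ^ e)) \<le> (\<Sum>i<e + 1. real p ^ i)"
    by (metis (mono_tags, lifting) of_nat_le_iff of_nat_power of_nat_sum sum.cong)
  then have "(real p - 1) * real (biunitary_sigma (p ^ e)) \<le> (real p - 1) * (\<Sum>i<e + 1. real p ^ i)"
    using p1 by (intro mult_left_mono) auto
  also have "\<dots> = real p ^ (e + 1) - 1" by (simp only: power_diff_1_eq)
  finally have "(real p - 1) * real (biunitary_sigma (p ^ e)) < real p * real p ^ e" by simp
  then show ?thesis using p1 by (simp add: biunitary_index_def field_simps)
qed

section \<open>Exact values at powers of 2 and at 25\<close>

lemma biunitary_sigma_power_of_2_even:
  assumes "k > 0"
  shows "biunitary_sigma (2 ^ (2 * k)) = (2 ^ k - 1) * (2 ^ (k + 1) + 1)"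
proof -
  have "(\<Sum>i<k. 2 ^ i :: nat) = 2 ^ k - 1" by (induction k) auto
  then show ?thesis using biunitary_sigma_prime_power_even[OF two_is_prime_nat assms] by simp
qed

lemma biunitary_sigma_power_of_2_odd:
  "biunitary_sigma (2 ^ (2 * m + 1)) = 2 ^ (2 * m + 2) - 1"
proof -
  have "(\<Sum>i<k. 2 ^ i :: nat) = 2 ^ k - 1" for k by (induction k) auto
  then show ?thesis using biunitary_sigma_prime_power_odd[OF two_is_prime_nat, of m]
    by (simp only:) simp
qed

lemma biunitary_index_power_of_2_even:
  assumes "k > 0"
  shows "biunitary_index (2 ^ (2 * k)) = (2 ^ k - 1) * (2 * 2 ^ k + 1) / (2 ^ k) ^ 2"
proof -
  have "real (biunitary_sigma (2 ^ (2 * k))) = (2 ^ k - 1) * (2 * 2 ^ k + 1)"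
    unfolding biunitary_sigma_power_of_2_even[OF assms] of_nat_mult by (simp add: of_nat_diff)
  moreover have "real (2 ^ (2 * k)) = (2 ^ k) ^ 2" by (simp add: mult.commute flip: power_mult)
  ultimately show ?thesis unfolding biunitary_index_def by simp
qed

lemma biunitary_index_power_of_2_odd:
  "biunitary_index (2 ^ (2 * m + 1)) = 2 - 1 / 2 ^ (2 * m + 1)"
  unfolding biunitary_index_def biunitary_sigma_power_of_2_odd
  by (simp add: of_nat_diff field_simps)

lemma biunitary_index_2: "biunitary_index 2 = 3 / 2"
  using biunitary_index_power_of_2_odd[of 0] by simp

lemma biunitary_index_4: "biunitary_index 4 = 5 / 4"
  using biunitary_index_power_of_2_even[of 1] by simp

lemma biunitary_index_16: "biunitary_index 16 = 27 / 16"
  using biunitary_index_power_of_2_even[of 2] by simp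

lemma biunitary_index_25: "biunitary_index 25 = 26 / 25"
  using biunitary_sigma_prime_square[of 5] by (simp add: biunitary_index_def)

section \<open>The contribution of the prime 2\<close>

lemma small_prime_factor:
  assumes "n > (1 :: nat)" "\<not> prime n"
  obtains q where "prime q" "q dvd n" "q ^ 2 \<le> n"
proof -
  obtain a where a: "a dvd n" "a \<noteq> 1" "a \<noteq> n" using assms unfolding prime_nat_iff by blast
  define b where "b = n div a"
  have n: "n = a * b" using a(1) by (simp add: b_def)
  have "a > 1" using a n assms(1) by (cases a) auto
  have "b > 1" using a n assms(1) by (cases "b = 0"; cases "b = 1") auto
  define c where "c = min a b"
  have c: "c > 1" "c dvd n" "c * c \<le> n"
    using \<open>a > 1\<close> \<open>b > 1\<close> unfolding c_def n by (auto simp: min_def)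
  obtain q where q: "prime q" "q dvd c" using c(1) prime_factor_nat[of c] by auto
  have "q \<le> c" using q c(1) by (simp add: dvd_imp_le)
  then have "q ^ 2 \<le> n" using c(3) mult_le_mono[of q c q c] by (simp add: power2_eq_square)
  then show ?thesis using that q c(2) dvd_trans by blast
qed

text \<open>Of the index of \<open>X\<close> only the contribution of \<open>q\<close> is kept; a
  value \<open>c * d\<close> above 2 then rules out a case below.\<close>

lemma index_power_of_2_mult_ge:
  assumes "prime q" "q dvd X" "X > 0" and b: "c \<ge> 0" "biunitary_index (2 ^ f) \<ge> c"
    "biunitary_index (q ^ multiplicity q X) \<ge> d"
  shows "biunitary_index (2 ^ f) * biunitary_index X \<ge> c * d"
proof -
  have "d \<le> biunitary_index X"
    using b(3) biunitary_index_ge_prime_power[OF assms(1,3)] by simp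
  moreover have "biunitary_index X \<ge> 0" by (simp add: biunitary_index_def)
  ultimately have "c * d \<le> c * biunitary_index X" using b(1) by (intro mult_left_mono)
  also have "\<dots> \<le> biunitary_index (2 ^ f) * biunitary_index X"
    using b(2) \<open>biunitary_index X \<ge> 0\<close> by (rule mult_right_mono)
  finally show ?thesis .
qed

lemma three_dvd_power_of_2_diff: "(3 :: nat) dvd 2 ^ (2 * j) - 1"
proof -
  have "[(4 :: nat) ^ j = 1 ^ j] (mod 3)" by (rule cong_pow) (simp add: cong_def)
  then have "(4 :: nat) ^ j mod 3 = 1" by (simp add: cong_def)
  then have "3 dvd (4 :: nat) ^ j - 1" by presburger
  then show ?thesis by (simp add: power_mult)
qed

text \<open>Each small prime factor of \<open>biunitary_sigma (2 ^ f)\<close> divides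
  \<open>X\<close> and raises its index. For \<open>f\<close> odd or divisible by 4 the prime 3 is
  such a factor; in the remaining case any factor small enough to make \<open>p\<close> or
  \<open>r\<close> composite breaks the bound 2. Later \<open>X\<close> is \<open>N\<close> for odd
  \<open>N\<close>, and \<open>biunitary_sigma N\<close> when that is odd.\<close>

lemma index_power_of_2_dvd_cases:
  assumes X: "odd X" and f: "f > 0" and dv: "biunitary_sigma (2 ^ f) dvd X"
    and le: "biunitary_index (2 ^ f) * biunitary_index X \<le> 2"
  obtains "f = 1" | "f = 2"
    | m p r where "m > 0" "f = 2 * (2 * m + 1)" "p = 2 ^ (2 * m + 1) - 1" "r = 2 ^ (2 * m + 2) + 1"
        "prime p" "prime r" "multiplicity p X = 2" "biunitary_sigma (2 ^ f) = p * r"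
  using f
proof (cases rule: exponent_cases)
  case (odd m)
  have X0: "X > 0" using X by (auto intro!: Nat.gr0I)
  have "3 dvd biunitary_sigma (2 ^ f)"
    using three_dvd_power_of_2_diff[of "m + 1"] biunitary_sigma_power_of_2_odd[of m] odd by simp
  then have "3 dvd X" using dv dvd_trans by blast
  then have "multiplicity 3 X > 0" using X0 by (simp add: prime_multiplicity_gt_zero_iff)
  then have i3: "biunitary_index (3 ^ multiplicity 3 X) \<ge> 10 / 9"
    using biunitary_index_prime_power_ge_square[of 3 "multiplicity 3 X"] by simp
  have "m = 0"
  proof (rule ccontr)
    assume "m \<noteq> 0"
    then have "(2 :: real) ^ 3 \<le> 2 ^ (2 * m + 1)" by (intro power_increasing) auto
    then have "1 / (2 :: real) ^ (2 * m + 1) \<le> 1 / 8" by (intro frac_le) auto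
    then have "biunitary_index (2 ^ f) \<ge> 15 / 8" using biunitary_index_power_of_2_odd[of m] odd by simp
    then have "biunitary_index (2 ^ f) * biunitary_index X \<ge> 15 / 8 * (10 / 9)"
      using i3 \<open>3 dvd X\<close> X0 by (intro index_power_of_2_mult_ge[of 3]) auto
    then show False using le by simp
  qed
  then show ?thesis using that(1) odd by simp
next
  case two
  then show ?thesis using that(2) by simp
next
  case (even m)
  have X0: "X > 0" using X by (auto intro!: Nat.gr0I)
  have sg: "biunitary_sigma (2 ^ f) = (2 ^ (2 * m) - 1) * (2 ^ (2 * m + 1) + 1)"
    using biunitary_sigma_power_of_2_even[of "2 * m"] even by simp
  have d3: "3 dvd X" using dv three_dvd_power_of_2_diff[of m] unfolding sg
    by (metis dvd_mult2 dvd_trans)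
  then have m3: "multiplicity 3 X > 0" using X0 by (simp add: prime_multiplicity_gt_zero_iff)
  show ?thesis
  \<comment> \<open>The case \<open>f = 4\<close> is separate: 27/16 times 10/9 is below 2, but here
    the divisor sum is 27, so \<open>3 ^ 3\<close> divides \<open>X\<close> and 10/9 improves to
    4/3.\<close>
  proof (cases "m = 1")
    case True
    then have "3 ^ 3 dvd X" using dv sg by simp
    then have "multiplicity 3 X \<ge> 3" using X0 by (intro multiplicity_geI) auto
    then have "biunitary_index (3 ^ multiplicity 3 X) \<ge> 4 / 3"
      using biunitary_index_prime_power_ge[of 3 "multiplicity 3 X"] by simp
    then have "biunitary_index (2 ^ f) * biunitary_index X \<ge> 27 / 16 * (4 / 3)"
      using d3 X0 True even biunitary_index_16 by (intro index_power_of_2_mult_ge[of 3]) auto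
    then show ?thesis using le by simp
  next
    case False
    have i3: "biunitary_index (3 ^ multiplicity 3 X) \<ge> 10 / 9"
      using biunitary_index_prime_power_ge_square[of 3 "multiplicity 3 X"] m3 by simp
    define y where "y = (2 :: real) ^ (2 * m)"
    have "(2 :: real) ^ 4 \<le> y" unfolding y_def by (rule power_increasing) (use even(2) False in auto)
    then have y: "y \<ge> 16" by simp
    \<comment> \<open>The constant 19/10 suffices because 19/10 times 10/9 exceeds 2.\<close>
    have "19 / 10 * y ^ 2 \<le> (y - 1) * (2 * y + 1)"
    proof -
      have "16 * y \<le> y * y" using y by (intro mult_right_mono) auto
      moreover have "(y - 1) * (2 * y + 1) = 2 * (y * y) - y - 1" by (simp add: algebra_simps)
      ultimately show ?thesis using y unfolding power2_eq_square by linarith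
    qed
    then have "19 / 10 \<le> (y - 1) * (2 * y + 1) / y ^ 2" using y by (simp only: pos_le_divide_eq zero_less_power)
    then have "19 / 10 \<le> biunitary_index (2 ^ f)"
      using biunitary_index_power_of_2_even[of "2 * m"] even by (simp add: y_def)
    then have "biunitary_index (2 ^ f) * biunitary_index X \<ge> 19 / 10 * (10 / 9)"
      using i3 d3 X0 by (intro index_power_of_2_mult_ge[of 3]) auto
    then show ?thesis using le by simp
  qed
next
  case (twice_odd m)
  have X0: "X > 0" using X by (auto intro!: Nat.gr0I)
  define k where "k = 2 * m + 1"
  define p :: nat where "p = 2 ^ k - 1"
  define r :: nat where "r = 2 ^ (k + 1) + 1"
  define y where "y = (2 :: real) ^ k"
  have f: "f = 2 * k" and k3: "k \<ge> 3" using twice_odd by (auto simp: k_def)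
  have sg: "biunitary_sigma (2 ^ f) = p * r"
    using biunitary_sigma_power_of_2_even[of k] f k3 by (simp add: p_def r_def)
  have idx: "biunitary_index (2 ^ f) = (y - 1) * (2 * y + 1) / y ^ 2"
    using biunitary_index_power_of_2_even[of k] f k3 by (simp add: y_def)
  have "(2 :: nat) ^ 3 \<le> 2 ^ k" by (rule power_increasing) (use k3 in auto)
  then have k8: "(8 :: nat) \<le> 2 ^ k" by simp
  then have y8: "y \<ge> 8" unfolding y_def by (metis of_nat_le_iff of_nat_numeral of_nat_power)
  have rp: "real p = y - 1" using k8 by (simp add: p_def y_def of_nat_diff)
  \<comment> \<open>The threshold is the multiple \<open>2 * 2 ^ k\<close> of 8 minus 7: above it
    the first number that is 1 modulo 8 is \<open>2 * 2 ^ k + 1 = r\<close>.\<close>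
  have large: "q ^ 2 > 2 * 2 ^ k - 7" if q: "prime q" "q dvd X" for q
  proof (rule ccontr)
    assume "\<not> ?thesis"
    then have "q ^ 2 + 7 \<le> 2 * 2 ^ k" using k8 by simp
    then have "real (q ^ 2 + 7) \<le> real (2 * 2 ^ k)" by (simp only: of_nat_le_iff)
    then have q2: "real q ^ 2 \<le> 2 * y - 7" by (simp add: y_def)
    have "multiplicity q X > 0" using q X0 by (simp add: prime_multiplicity_gt_zero_iff)
    then have "1 + 1 / real q ^ 2 \<le> biunitary_index (q ^ multiplicity q X)"
      using biunitary_index_prime_power_ge_square q by blast
    moreover have "1 / (2 * y - 7) \<le> 1 / real q ^ 2"
      using q2 prime_gt_0_nat[OF q(1)] y8 by (intro divide_left_mono mult_pos_pos) auto
    ultimately have "1 + 1 / (2 * y - 7) \<le> biunitary_index (q ^ multiplicity q X)" by simp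
    then have "(y - 1) * (2 * y + 1) / y ^ 2 * (1 + 1 / (2 * y - 7)) \<le> 2"
      using index_power_of_2_mult_ge[OF q X0, of "(y - 1) * (2 * y + 1) / y ^ 2" f] le idx y8 by force
    moreover have "1 + 1 / (2 * y - 7) = (2 * y - 6) / (2 * y - 7)" using y8 by (simp add: field_simps)
    ultimately have "((y - 1) * (2 * y + 1) * (2 * y - 6)) / (y ^ 2 * (2 * y - 7)) \<le> 2" by simp
    moreover have "y ^ 2 * (2 * y - 7) > 0" using y8 by simp
    ultimately have "(y - 1) * (2 * y + 1) * (2 * y - 6) \<le> 2 * (y ^ 2 * (2 * y - 7))"
      by (simp add: pos_divide_le_eq)
    \<comment> \<open>The cubic and quadratic terms cancel.\<close>
    then have "4 * y + 6 \<le> 0" by (simp add: power2_eq_square algebra_simps)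
    then show False using y8 by simp
  qed
  have pX: "p dvd X" and rX: "r dvd X" using dv unfolding sg by (auto dest: dvd_mult_left dvd_mult_right)
  have "prime p"
  proof (rule ccontr)
    assume "\<not> prime p"
    moreover have "p > 1" using k8 by (simp add: p_def)
    ultimately obtain q where q: "prime q" "q dvd p" "q ^ 2 \<le> p" using small_prime_factor by blast
    then have "q ^ 2 > 2 * 2 ^ k - 7" using large pX dvd_trans by blast
    then show False using q(3) k8 by (simp add: p_def)
  qed
  have "prime r"
  proof (rule ccontr)
    assume "\<not> prime r"
    moreover have "r > 1" by (simp add: r_def)
    ultimately obtain q where q: "prime q" "q dvd r" "q ^ 2 \<le> r" using small_prime_factor by blast
    then have qX: "q dvd X" using rX dvd_trans by blast
    have gt: "q ^ 2 > 2 * 2 ^ k - 7" using large q(1) qX by blast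
    have "odd q" using qX X dvd_trans by blast
    then obtain j where j: "q = 2 * j + 1" using oddE by blast
    have "even (j ^ 2 + j)" by simp
    then obtain i where "j ^ 2 + j = 2 * i" by blast
    then have q8: "q ^ 2 = 8 * i + 1" using j by (simp add: power2_eq_square algebra_simps)
    have "(2 :: nat) ^ k = 8 * 2 ^ (k - 3)" using k3 power_add[of "2 :: nat" 3 "k - 3"] by simp
    \<comment> \<open>Both \<open>q^2 - 1\<close> and \<open>2^(k + 1)\<close> are multiples of 8, and \<open>q^2 - 1\<close> lies within 8 of \<open>2^(k + 1)\<close>.\<close>
    then have eq: "q ^ 2 = 2 * 2 ^ k + 1" using q8 gt q(3) by (simp add: r_def)
    \<comment> \<open>Since \<open>k + 1\<close> is even, \<open>q ^ 2\<close> would be the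
      successor of a positive square.\<close>
    have "2 * 2 ^ k = (2 ^ (m + 1) :: nat) ^ 2"
      by (simp add: k_def power2_eq_square flip: power_add)
    then have sq: "q ^ 2 = (2 ^ (m + 1)) ^ 2 + 1" using eq by simp
    then have "q > 2 ^ (m + 1)" by (metis less_add_one power2_less_imp_less zero_le)
    then have "(2 ^ (m + 1) + 1) ^ 2 \<le> q ^ 2" by (intro power_mono) auto
    then show False using sq by (simp add: power2_eq_square algebra_simps)
  qed
  have "multiplicity p X = 2"
  proof (rule ccontr)
    assume "multiplicity p X \<noteq> 2"
    moreover have "multiplicity p X > 0" using pX \<open>prime p\<close> X0 by (simp add: prime_multiplicity_gt_zero_iff)
    ultimately have "1 + 1 / real p \<le> biunitary_index (p ^ multiplicity p X)"
      using biunitary_index_prime_power_ge \<open>prime p\<close> by blast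
    then have "(y - 1) * (2 * y + 1) / y ^ 2 * (1 + 1 / (y - 1)) \<le> 2"
      using index_power_of_2_mult_ge[OF \<open>prime p\<close> pX X0, of "(y - 1) * (2 * y + 1) / y ^ 2" f]
        le idx y8 rp by force
    \<comment> \<open>The factor \<open>1 + 1 / p = y / (y - 1)\<close> cancels \<open>y - 1\<close>
      and leaves \<open>2 + 1 / y\<close>.\<close>
    moreover have "(y - 1) * (2 * y + 1) / y ^ 2 * (1 + 1 / (y - 1)) = (2 * y + 1) / y"
      using y8 by (simp add: field_simps power2_eq_square)
    ultimately have "(2 * y + 1) / y \<le> 2" by simp
    then have "2 * y + 1 \<le> 2 * y" using y8 by (simp add: pos_divide_le_eq)
    then show False by simp
  qed
  then show ?thesis
    using that(3)[of m p r] twice_odd sg \<open>prime p\<close> \<open>prime r\<close> by (simp add: p_def r_def k_def)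
qed

section \<open>Odd numbers\<close>

text \<open>As \<open>N\<close> is odd, 4 does not divide \<open>2 * N\<close>, so the odd part of
  \<open>biunitary_sigma N\<close> is a prime power. It is not 1, because the divisor sum of a power
  of 2 is odd; this oddness also moves \<open>biunitary_sigma (2 ^ f)\<close> from a divisor of
  \<open>2 * N\<close> to a divisor of \<open>N\<close>.\<close>

lemma biunitary_superperfect_odd_structure:
  assumes N: "odd N" and eq: "biunitary_sigma (biunitary_sigma N) = 2 * N"
  obtains f q b where "f > 0" "b > 0" "prime q" "odd q" "biunitary_sigma N = 2 ^ f * q ^ b"
    "biunitary_sigma (2 ^ f) dvd N"
    "2 * N = biunitary_sigma (2 ^ f) * biunitary_sigma (q ^ b)"
    "biunitary_index (2 ^ f) * biunitary_index (q ^ b) * biunitary_index N = 2"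
    "biunitary_index (2 ^ f) * biunitary_index N \<le> 2"
proof -
  define M where "M = biunitary_sigma N"
  have N0: "N > 0" using N by (auto intro!: Nat.gr0I)
  have "N \<noteq> 1" using eq biunitary_sigma_1 by auto
  then have "even M" using even_biunitary_sigma[of N] N N0 by (simp add: M_def)
  have M0: "M > 0" using biunitary_sigma_ge[OF N0] N0 by (simp add: M_def)
  define f where "f = multiplicity 2 M"
  obtain y where y: "M = 2 ^ f * y" "odd y" "f > 0" "coprime (2 ^ f) y" "y > 0"
    and sM: "biunitary_sigma M = biunitary_sigma (2 ^ f) * biunitary_sigma y"
    using prime_power_split[OF M0 two_is_prime_nat \<open>even M\<close>] unfolding f_def by metis
  have two_N: "2 * N = biunitary_sigma (2 ^ f) * biunitary_sigma y" using eq sM by (simp add: M_def)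
  have "y \<noteq> 1"
  proof
    assume "y = 1"
    then have "odd (2 * N)" using two_N odd_biunitary_sigma_power_of_2 biunitary_sigma_1 by simp
    then show False by simp
  qed
  moreover have "\<not> 4 dvd biunitary_sigma y"
  proof
    assume "4 dvd biunitary_sigma y"
    then have "4 dvd 2 * N" unfolding two_N by simp
    then show False using N by presburger
  qed
  ultimately obtain q b where qb: "prime q" "odd q" "b > 0" "y = q ^ b"
    using prime_power_of_not_4_dvd_biunitary_sigma[OF y(2)] y(5) by (metis nat_neq_iff less_one neq0_conv)
  have "coprime (biunitary_sigma (2 ^ f)) 2" using odd_biunitary_sigma_power_of_2 by simp
  moreover have "biunitary_sigma (2 ^ f) dvd 2 * N" unfolding two_N by simp
  ultimately have dv: "biunitary_sigma (2 ^ f) dvd N" by (simp add: coprime_dvd_mult_right_iff)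
  have "biunitary_index M * biunitary_index N = 2"
    using eq M0 N0 by (simp add: biunitary_index_def flip: M_def)
  moreover have "biunitary_index M = biunitary_index (2 ^ f) * biunitary_index y"
    using y(4,5) unfolding y(1) by (intro biunitary_index_mult) auto
  ultimately have idx: "biunitary_index (2 ^ f) * biunitary_index y * biunitary_index N = 2" by simp
  have "biunitary_index (2 ^ f) * biunitary_index N * 1 \<le>
      biunitary_index (2 ^ f) * biunitary_index N * biunitary_index y"
    using biunitary_index_ge_1[OF y(5)] by (intro mult_left_mono) (auto simp: biunitary_index_def)
  then have "biunitary_index (2 ^ f) * biunitary_index N \<le> 2" using idx by (simp add: mult_ac)
  then show ?thesis using that[of f b q] y qb dv two_N idx by (simp add: M_def)
qed

lemma odd_prime_dvd_2_power_mult_power: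
  fixes t :: nat
  assumes "prime t" "odd t" "prime q" "t dvd 2 ^ f * q ^ b"
  shows "t = q"
proof -
  have "t dvd q ^ b"
    using assms prime_dvd_mult_iff[of t] prime_dvd_power[of t 2 f] primes_dvd_imp_eq two_is_prime_nat
    by (metis dvd_refl)
  then show ?thesis using assms prime_dvd_power primes_dvd_imp_eq by blast
qed

text \<open>An exponent \<open>2 * (2 * m + 1)\<close> with \<open>m > 0\<close> would put two
  different odd primes into \<open>biunitary_sigma N\<close>, where only \<open>q\<close> is
  possible.\<close>

lemma odd_exponent_cases:
  assumes N: "odd N" "prime r" "r dvd N" and M: "biunitary_sigma N = 2 ^ f * q ^ b" and q: "prime q"
  obtains "r + 1 dvd biunitary_sigma N" "multiplicity r N \<noteq> 2" | "multiplicity r N = 2"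
proof -
  have N0: "N > 0" using N by (auto intro!: Nat.gr0I)
  have r: "odd r" using N dvd_trans by blast
  have e: "multiplicity r N > 0" using N N0 by (simp add: prime_multiplicity_gt_zero_iff)
  note dv = biunitary_sigma_prime_power_dvd[OF N0 N(2,3)]
  show ?thesis
  proof (cases "\<exists>m. multiplicity r N = 2 * (2 * m + 1)")
    case False
    then have "multiplicity r N \<noteq> 2" by (metis mult.right_neutral mult_0_right plus_nat.add_0)
    then show ?thesis using that(1) Suc_dvd_biunitary_sigma[OF N(2) e False] dv dvd_trans by blast
  next
    case True
    then obtain m where m: "multiplicity r N = 2 * (2 * m + 1)" by blast
    have "m = 0"
    proof (rule ccontr)
      assume "m \<noteq> 0"
      then obtain s t where st: "prime s" "prime t" "odd s" "odd t" "s \<noteq> t"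
          "s * t dvd biunitary_sigma (r ^ (2 * (2 * m + 1)))"
        using biunitary_sigma_twice_odd_exponent[OF N(2) r, of m] by blast
      then have "s * t dvd 2 ^ f * q ^ b" using dv M dvd_trans unfolding m by metis
      then have "s = q" "t = q"
        using st(1-4) q odd_prime_dvd_2_power_mult_power by (metis dvd_mult_left dvd_mult_right)+
      then show False using st(5) by simp
    qed
    then show ?thesis using that(2) m by simp
  qed
qed

text \<open>Meant for \<open>n = s ^ 2 + 1\<close> with \<open>s\<close> an odd prime, whose half is
  odd and therefore built from \<open>q\<close> alone.\<close>

lemma dvd_2_power_mult_power_eq:
  fixes n :: nat
  assumes "n dvd 2 ^ f * q ^ b" "prime q" "odd q" "n = 2 * w" "odd w"
  obtains t where "w = q ^ t"
proof -
  have "w dvd 2 ^ f * q ^ b" using assms(1,4) by (metis dvd_mult_right)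
  moreover have "coprime w (2 ^ f)" using assms(5) by simp
  ultimately have "w dvd q ^ b" by (simp add: coprime_dvd_mult_right_iff)
  then show ?thesis using that assms(2) by (auto simp: divides_primepow_nat)
qed

text \<open>With \<open>X = N\<close>, the lemma \<open>index_power_of_2_dvd_cases\<close> leaves
  three shapes of \<open>f\<close>: \<open>f = 1\<close> leads to 9, the other two to
  contradictions.\<close>

lemma biunitary_superperfect_odd:
  assumes N: "odd N" and eq: "biunitary_sigma (biunitary_sigma N) = 2 * N"
  shows "N = 9"
proof -
  have N0: "N > 0" using N by (auto intro!: Nat.gr0I)
  obtain f q b where f0: "f > 0" and b0: "b > 0" and q: "prime q" "odd q"
    and M: "biunitary_sigma N = 2 ^ f * q ^ b" and dv: "biunitary_sigma (2 ^ f) dvd N"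
    and two_N: "2 * N = biunitary_sigma (2 ^ f) * biunitary_sigma (q ^ b)"
    and idx: "biunitary_index (2 ^ f) * biunitary_index (q ^ b) * biunitary_index N = 2"
    and le: "biunitary_index (2 ^ f) * biunitary_index N \<le> 2"
    by (rule biunitary_superperfect_odd_structure[OF assms])
  have N1: "N > 1"
  proof (rule ccontr)
    assume "\<not> N > 1"
    then have "N = 1" using N0 by simp
    then show False using eq biunitary_sigma_1 by simp
  qed
  have q_unique: "t = q" if "prime t" "odd t" "t dvd biunitary_sigma N" for t
    using that odd_prime_dvd_2_power_mult_power[OF that(1,2) q(1)] M by simp
  show ?thesis
    using N f0 dv le
  proof (cases rule: index_power_of_2_dvd_cases)
    case 1
    \<comment> \<open>For \<open>f = 1\<close> this makes \<open>N\<close> a prime power,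
      necessarily of 3 as \<open>biunitary_sigma 2 = 3\<close> divides \<open>N\<close>; an exponent
      other than 2 would bring in the factor \<open>3 + 1\<close>.\<close>
    have not4: "\<not> 4 dvd biunitary_sigma N"
    proof
      assume "4 dvd biunitary_sigma N"
      then have "2 * 2 dvd 2 * q ^ b" using M 1 by simp
      then have "2 dvd q ^ b" by (simp only: dvd_times_left_cancel_iff zero_neq_numeral[symmetric] not_False_eq_True)
      then show False using q by simp
    qed
    obtain p e where pe: "prime p" "odd p" "e > 0" "N = p ^ e"
      by (rule prime_power_of_not_4_dvd_biunitary_sigma[OF N N1 not4])
    have "3 dvd N" using dv biunitary_sigma_prime[of 2] 1 by simp
    then have "3 dvd p" using pe(4) prime_dvd_power[of "3 :: nat" p e] by simp
    then have "p = 3" using pe(1) primes_dvd_imp_eq[of 3 p] by simp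
    have "multiplicity 3 N = 2"
      using N _ \<open>3 dvd N\<close> M q(1)
    proof (rule odd_exponent_cases)
      assume "3 + 1 dvd biunitary_sigma N"
      then show ?thesis using not4 by simp
    qed auto
    then have "e = 2" using pe \<open>p = 3\<close> by simp
    then show ?thesis using pe \<open>p = 3\<close> by simp
  next
    case 2
    have i4: "biunitary_index (2 ^ f) = 5 / 4" using 2 biunitary_index_4 by simp
    have s4: "biunitary_sigma (2 ^ f) = 5" using 2 biunitary_sigma_prime_square[of 2] by simp
    have p5: "prime (5 :: nat)" "prime (13 :: nat)" "prime (3 :: nat)" by simp_all
    have d5: "5 dvd N" using dv s4 by simp
    have e0: "multiplicity 5 N > 0" using d5 N0 by (simp add: prime_multiplicity_gt_zero_iff)
    have False
      using N p5(1) d5 M q(1)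
    proof (cases rule: odd_exponent_cases)
      case 1
      then have "2 * 3 dvd biunitary_sigma N" by simp
      then have "3 dvd biunitary_sigma N" by (rule dvd_mult_right)
      then have "q = 3" using q_unique[of 3] by simp
      consider "b = 1" | "b = 2" | "b \<ge> 3" using b0 by linarith
      then show False
      proof cases
        case 1
        then have "2 * N = 5 * 4" using two_N s4 \<open>q = 3\<close> biunitary_sigma_prime[of 3] by simp
        then show False using N by presburger
      next
        case 2
        then have "2 * N = 5 * 10" using two_N s4 \<open>q = 3\<close> biunitary_sigma_prime_square[of 3] by simp
        then have "N = 5 ^ 2" by simp
        then have "biunitary_sigma N = 26" using biunitary_sigma_prime_square[of 5] by simp
        then have "13 dvd biunitary_sigma N" by simp
        then show False using q_unique[of 13] \<open>q = 3\<close> by simp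
      next
        case 3
        \<comment> \<open>Strictness is essential: 5/4 times 4/3 times 6/5 is exactly 2.\<close>
        then have i3: "biunitary_index (q ^ b) > 4 / 3"
          using biunitary_index_prime_power_gt[of 3 b] \<open>q = 3\<close> by simp
        have "biunitary_index N \<ge> 6 / 5"
          using biunitary_index_ge_prime_power[OF p5(1) N0]
            biunitary_index_prime_power_ge[OF p5(1) e0 1(2)] by simp
        then have "biunitary_index (q ^ b) * biunitary_index N > 4 / 3 * (6 / 5)"
          using i3 by (intro mult_less_le_imp_less) auto
        then show False using idx i4 by simp
      qed
    next
      case 2
      \<comment> \<open>Here the contradiction comes from upper bounds: \<open>q = 13\<close> and
        \<open>y\<close> is a power of a prime \<open>r >= 7\<close>, so the three indices multiply
        to less than 2.\<close>
      obtain y where y: "N = 5 ^ 2 * y" "y > 0" "\<not> 5 dvd y" "coprime (5 ^ 2) y"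
        "biunitary_sigma N = biunitary_sigma (5 ^ 2) * biunitary_sigma y"
        using prime_power_split[OF N0 p5(1) d5] unfolding 2 by metis
      have sN: "biunitary_sigma N = 26 * biunitary_sigma y"
        using y(5) biunitary_sigma_prime_square[of 5] by simp
      have "13 dvd biunitary_sigma N" unfolding sN by (rule dvd_mult2) simp
      then have "q = 13" using q_unique[of 13] by simp
      have odd_y: "odd y" using y(1) N by simp
      have eq4: "26 * biunitary_sigma y = 4 * 13 ^ b" using sN M \<open>q = 13\<close> \<open>f = 2\<close> by simp
      have "\<not> 4 dvd biunitary_sigma y"
      proof
        assume "4 dvd biunitary_sigma y"
        then obtain z where "biunitary_sigma y = 4 * z" by blast
        then have "26 * z = 13 ^ b" using eq4 by simp
        then have "even (13 ^ b :: nat)" by (metis dvd_triv_left dvd_mult2 even_numeral)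
        then show False by simp
      qed
      moreover have "y \<noteq> 1"
      proof
        assume "y = 1"
        then have "26 = 4 * (13 ^ b :: nat)" using eq4 biunitary_sigma_1 by simp
        then show False by presburger
      qed
      ultimately obtain r c where rc: "prime r" "odd r" "c > 0" "y = r ^ c"
        using prime_power_of_not_4_dvd_biunitary_sigma[OF odd_y] y(2)
        by (metis nat_neq_iff less_one neq0_conv)
      have rN: "r dvd N" using y(1) rc by simp
      have "r \<noteq> 5" using y(3) rc by auto
      \<comment> \<open>The prime 3 must be excluded separately, since the bound
        \<open>r / (r - 1) = 3 / 2\<close> would allow a product above 2.\<close>
      have "r \<noteq> 3"
      proof
        assume "r = 3"
        have c: "multiplicity 3 N = c"
          using \<open>r = 3\<close> y(1) rc
          by (subst y(1), subst prime_elem_multiplicity_mult_distrib)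
            (auto simp: not_dvd_imp_multiplicity_0)
        have "c \<noteq> 2"
        proof
          assume "c = 2"
          then have "biunitary_sigma y = 10" using biunitary_sigma_prime_square[of 3] rc \<open>r = 3\<close> by simp
          then have "5 dvd biunitary_sigma N" using sN by simp
          then show False using q_unique[of 5] \<open>q = 13\<close> by simp
        qed
        have "\<not> (\<exists>m. c = 2 * (2 * m + 1))"
        proof
          assume "\<exists>m. c = 2 * (2 * m + 1)"
          then obtain m where m: "c = 2 * (2 * m + 1)" by blast
          with \<open>c \<noteq> 2\<close> have "m > 0" by (cases m) auto
          then obtain s t where st: "prime s" "prime t" "odd s" "odd t" "s \<noteq> t"
              "s * t dvd biunitary_sigma y"
            using biunitary_sigma_twice_odd_exponent[of 3 m] m rc \<open>r = 3\<close> by auto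
          then have "s * t dvd biunitary_sigma N" unfolding sN by simp
          then have "s = q" "t = q" using q_unique st by (metis dvd_mult_left dvd_mult_right)+
          then show False using st(5) by simp
        qed
        then have "3 + 1 dvd biunitary_sigma y"
          using Suc_dvd_biunitary_sigma[of 3 c] rc \<open>r = 3\<close> by simp
        then show False using \<open>\<not> 4 dvd biunitary_sigma y\<close> by simp
      qed
      have "r \<ge> 7"
      proof (rule ccontr)
        assume "\<not> r \<ge> 7"
        then have "r \<in> {0, 1, 2, 3, 4, 5, 6}" by auto
        then show False using rc(1,2) \<open>r \<noteq> 3\<close> \<open>r \<noteq> 5\<close> by auto
      qed
      then have "real r / (real r - 1) \<le> 7 / 6" by (simp add: field_simps)
      then have i1: "biunitary_index y \<le> 7 / 6"
        using biunitary_index_prime_power_less[OF rc(1,3)] unfolding rc(4) by linarith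
      have i2: "biunitary_index (q ^ b) \<le> 13 / 12"
        using biunitary_index_prime_power_less[of 13 b] b0 \<open>q = 13\<close> by simp
      have "biunitary_index N = 26 / 25 * biunitary_index y"
        using biunitary_index_mult[OF y(4)] y(1,2) biunitary_index_25 by simp
      have "5 / 4 * (26 / 25) * (biunitary_index (q ^ b) * biunitary_index y) = 2"
        using idx unfolding i4 \<open>biunitary_index N = 26 / 25 * biunitary_index y\<close>
        by (simp only: mult_ac)
      moreover have "biunitary_index (q ^ b) * biunitary_index y \<le> 13 / 12 * (7 / 6)"
        using i1 i2 by (intro mult_mono) (auto simp: biunitary_index_def)
      ultimately show False by simp
    qed
    then show ?thesis ..
  next
    case (3 m p r)
    have "p dvd N" "r dvd N" using dv 3(8) by (metis dvd_mult_left dvd_mult_right)+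
    have "(2 :: nat) ^ 3 \<le> 2 ^ (2 * m + 1)" by (rule power_increasing) (use 3(1) in auto)
    \<comment> \<open>Both \<open>p\<close> and \<open>r\<close> are linear in \<open>x\<close>; the
      halves of \<open>p ^ 2 + 1\<close> and \<open>r ^ 2 + 1\<close> become odd quadratics in
      \<open>x\<close> that can be compared.\<close>
    define x where "x = (2 :: nat) ^ (2 * m)"
    have x: "x \<ge> 4" using \<open>2 ^ 3 \<le> 2 ^ (2 * m + 1)\<close> by (simp add: x_def)
    have "even x" using 3(1) by (simp add: x_def)
    have p: "p = 2 * x - 1" and r: "r = 4 * x + 1" using 3(3,4) by (simp_all add: x_def)
    have p0: "p + 1 = 2 * x" using p x by simp
    have sqp: "p ^ 2 + 1 = 2 * (2 * x ^ 2 - 2 * x + 1)"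
    proof -
      \<comment> \<open>This substitution removes the truncated subtractions.\<close>
      obtain z where z: "x = Suc z" using x by (cases x) auto
      then have "p = 2 * z + 1" using p by simp
      moreover have "2 * x ^ 2 - 2 * x = 2 * z ^ 2 + 2 * z"
        using z by (simp add: power2_eq_square)
      ultimately show ?thesis by (simp add: power2_eq_square)
    qed
    have sqr: "r ^ 2 + 1 = 2 * (8 * x ^ 2 + 4 * x + 1)"
      using r by (simp add: power2_eq_square algebra_simps)
    have "p ^ 2 + 1 dvd biunitary_sigma N"
      using biunitary_sigma_prime_power_dvd[OF N0 3(5) \<open>p dvd N\<close>]
        biunitary_sigma_prime_square[OF 3(5)] 3(7) by simp
    then have "p ^ 2 + 1 dvd 2 ^ f * q ^ b" using M by simp
    then obtain t where t: "2 * x ^ 2 - 2 * x + 1 = q ^ t"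
      using dvd_2_power_mult_power_eq[OF _ q sqp] by auto
    \<comment> \<open>As \<open>x = 4 ^ m\<close> is 1 modulo 3, so is
      \<open>2 * x ^ 2 - 2 * x + 1 = q ^ t\<close>. Below, \<open>r + 1\<close> is divisible by 3,
      which excludes every exponent of \<open>r\<close> except 2.\<close>
    have "q \<noteq> 3"
    proof
      assume "q = 3"
      have "x ^ 2 \<ge> x" using x by (simp add: power2_eq_square)
      then have "2 * x ^ 2 + 1 = q ^ t + 2 * x" using t by simp
      have "x ^ 2 > x" using x by (simp add: power2_eq_square)
      then have "q ^ t \<noteq> 1" using t by linarith
      then have "3 dvd q ^ t" using \<open>q = 3\<close> by (cases t) auto
      moreover have "x mod 3 = 1"
      proof -
        have "[(4 :: nat) ^ m = 1 ^ m] (mod 3)" by (rule cong_pow) (simp add: cong_def)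
        then show ?thesis by (simp add: x_def power_mult cong_def)
      qed
      then obtain i where i: "x = 3 * i + 1" by (metis mult_div_mod_eq)
      have "x ^ 2 = 3 * (3 * i ^ 2 + 2 * i) + 1" using i by (simp add: power2_eq_square algebra_simps)
      ultimately show False using \<open>2 * x ^ 2 + 1 = q ^ t + 2 * x\<close> i by presburger
    qed
    show ?thesis
      using N 3(6) \<open>r dvd N\<close> M q(1)
    proof (cases rule: odd_exponent_cases)
      case 1
      have "[(4 :: nat) ^ (m + 1) = 1 ^ (m + 1)] (mod 3)" by (rule cong_pow) (simp add: cong_def)
      then have "(4 * x) mod 3 = 1" by (simp add: x_def power_mult cong_def)
      then have "3 dvd r + 1" using r by presburger
      then have "3 dvd biunitary_sigma N" using 1 dvd_trans by blast
      then show ?thesis using q_unique[of 3] \<open>q \<noteq> 3\<close> by simp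
    next
      case 2
      have "r ^ 2 + 1 dvd biunitary_sigma N"
        using biunitary_sigma_prime_power_dvd[OF N0 3(6) \<open>r dvd N\<close>]
          biunitary_sigma_prime_square[OF 3(6)] 2 by simp
      then have "r ^ 2 + 1 dvd 2 ^ f * q ^ b" using M by simp
      then obtain u where u: "8 * x ^ 2 + 4 * x + 1 = q ^ u"
        using dvd_2_power_mult_power_eq[OF _ q sqr] \<open>even x\<close> by auto
      have xx: "x ^ 2 \<ge> x" using x by (simp add: power2_eq_square)
      \<comment> \<open>Of two powers of \<open>q\<close> the smaller divides the larger, hence also
        \<open>q ^ u - 4 * q ^ t\<close>, where the quadratic terms cancel. A quadratic in
        \<open>x\<close> thus divides \<open>12 * x - 3\<close>, too small for
        \<open>x >= 16\<close>; for \<open>x = 4\<close>, 25 does not divide 45.\<close>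
      have "q ^ t \<le> q ^ u" using t u xx by linarith
      then have "q ^ t dvd q ^ u" using prime_gt_1_nat[OF q(1)] by (simp add: le_imp_power_dvd)
      moreover have "q ^ u - 4 * q ^ t = 12 * x - 3" "4 * q ^ t \<le> q ^ u" using t u xx x by linarith+
      ultimately have dvd_x: "q ^ t dvd 12 * x - 3" by (metis dvd_diff_nat dvd_mult dvd_refl)
      have False
      proof (cases "x = 4")
        case True
        then have "q ^ t = 25" using t by simp
        then show False using dvd_x True by simp
      next
        case False
        have "q ^ t \<le> 12 * x - 3" using dvd_x x by (intro dvd_imp_le) auto
        moreover have "m \<noteq> 1" using False by (auto simp: x_def)
        then have "(2 :: nat) ^ 4 \<le> x" unfolding x_def using 3(1) by (intro power_increasing) auto
        then have "16 * x \<le> x ^ 2" by (simp add: power2_eq_square)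
        ultimately show False using t x by linarith
      qed
      then show ?thesis ..
    qed
  qed
qed

section \<open>Even numbers\<close>

text \<open>
  For even \<open>N\<close> and \<open>M = \<sigma> N\<close> the conditions on \<open>N\<close> and \<open>M\<close> used below are symmetric, so the next two lemmas
  are applied with \<open>A\<close> and \<open>B\<close> in either order.
\<close>

lemma even_superperfect_index_power_of_2:
  assumes pos: "A > 0" "B > 0" and ev: "even A" "even B"
    and idx: "biunitary_index A * biunitary_index B = 2"
    and dv: "3 dvd biunitary_sigma B \<Longrightarrow> 3 dvd A"
    and A2: "multiplicity 2 A = 2"
  shows "multiplicity 2 B = 2"
proof (rule ccontr)
  assume ne: "multiplicity 2 B \<noteq> 2"
  define e where "e = multiplicity 2 B"
  have e0: "e > 0" using ev pos by (simp add: e_def prime_multiplicity_gt_zero_iff)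
  have iB: "biunitary_index (2 ^ e) \<le> biunitary_index B"
    using biunitary_index_ge_prime_power[OF two_is_prime_nat pos(2)] by (simp add: e_def)
  show False
  proof (cases "e = 1")
    case True
    \<comment> \<open>The prime 3 in \<open>A\<close> lifts the product of the indices to 5/4 times
      10/9 times 3/2, which is 25/12.\<close>
    have "3 dvd biunitary_sigma B"
      using biunitary_sigma_prime_power_dvd[OF pos(2) two_is_prime_nat ev(2)] biunitary_sigma_prime[of 2] True
      by (simp add: e_def)
    then have "3 dvd A" by (rule dv)
    then have "multiplicity 3 A > 0" using pos by (simp add: prime_multiplicity_gt_zero_iff)
    then have "biunitary_index (3 ^ multiplicity 3 A) \<ge> 10 / 9"
      using biunitary_index_prime_power_ge_square[of 3] by simp
    then have "biunitary_index A \<ge> 5 / 4 * (10 / 9)"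
      using biunitary_index_ge_prod[of "{2, 3}" A] A2 biunitary_index_4 pos by simp
    then have "biunitary_index A * biunitary_index B \<ge> 5 / 4 * (10 / 9) * (3 / 2)"
      using iB True biunitary_index_2 by (intro mult_mono) auto
    then show False using idx by simp
  next
    case False
    then have "e \<ge> 3" using e0 ne by (simp add: e_def)
    then consider "e = 3" | "e = 4" | "e \<ge> 5" by linarith
    \<comment> \<open>The general bound 3/2 would give only 15/8 in the product; 27/16 is the value
      at \<open>e = 4\<close>.\<close>
    then have "biunitary_index (2 ^ e) \<ge> 27 / 16"
    proof cases
      case 1 then show ?thesis using biunitary_index_power_of_2_odd[of 1] by simp
    next
      case 2 then show ?thesis using biunitary_index_16 by simp
    next
      case 3 then show ?thesis using biunitary_index_prime_power_ge_5[of 2 e] by simp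
    qed
    moreover have "biunitary_index A \<ge> 5 / 4"
      using biunitary_index_ge_prime_power[OF two_is_prime_nat pos(1)] A2 biunitary_index_4 by simp
    ultimately have "biunitary_index A * biunitary_index B \<ge> 5 / 4 * (27 / 16)"
      using iB by (intro mult_mono) auto
    then show False using idx by simp
  qed
qed

lemma even_superperfect_index_power_of_5:
  assumes pos: "A > 0" "B > 0" and d5: "5 dvd A" "5 dvd B"
    and idx: "biunitary_index A * biunitary_index B = 2"
    and dv: "3 dvd biunitary_sigma B \<Longrightarrow> 3 dvd A"
    and two: "multiplicity 2 A = 2" "multiplicity 2 B = 2" and A5: "multiplicity 5 A = 2"
  shows "multiplicity 5 B = 2"
proof (rule ccontr)
  assume ne: "multiplicity 5 B \<noteq> 2"
  define b where "b = multiplicity 5 B"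
  have b0: "b > 0" using d5 pos by (simp add: b_def prime_multiplicity_gt_zero_iff)
  have iB: "5 / 4 * biunitary_index (5 ^ b) \<le> biunitary_index B"
    using biunitary_index_ge_prod[of "{2, 5}" B] two biunitary_index_4 pos by (simp add: b_def)
  show False
  proof (cases "\<exists>m. b = 2 * (2 * m + 1)")
    case True
    then obtain m where m: "b = 2 * (2 * m + 1)" by blast
    \<comment> \<open>The two-term bound 6/5 would give only 39/20 in the product, so the three-term
      bound 31/25 is used.\<close>
    then have "b \<ge> 5" using ne by (cases "m = 0") (auto simp: b_def)
    then have "biunitary_index (5 ^ b) \<ge> 31 / 25" using biunitary_index_prime_power_ge_5[of 5 b] by simp
    then have "biunitary_index B \<ge> 31 / 20" using iB by linarith
    moreover have "biunitary_index A \<ge> 13 / 10"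
      using biunitary_index_ge_prod[of "{2, 5}" A] two A5 biunitary_index_4 biunitary_index_25 pos by simp
    ultimately have "biunitary_index A * biunitary_index B \<ge> 13 / 10 * (31 / 20)"
      by (intro mult_mono) auto
    then show False using idx by simp
  next
    case False
    have "5 + 1 dvd biunitary_sigma B"
    proof (rule dvd_trans)
      show "5 + 1 dvd biunitary_sigma (5 ^ b)"
        by (rule Suc_dvd_biunitary_sigma[OF _ b0 False]) simp
      show "biunitary_sigma (5 ^ b) dvd biunitary_sigma B"
        using biunitary_sigma_prime_power_dvd[of B 5] pos d5 by (simp add: b_def)
    qed
    then have "2 * 3 dvd biunitary_sigma B" by simp
    then have "3 dvd A" using dv dvd_mult_right by blast
    then have "multiplicity 3 A > 0" using pos by (simp add: prime_multiplicity_gt_zero_iff)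
    then have i3: "biunitary_index (3 ^ multiplicity 3 A) \<ge> 10 / 9"
      using biunitary_index_prime_power_ge_square[of 3] by simp
    then have "biunitary_index A \<ge> 13 / 10 * (10 / 9)"
      using biunitary_index_ge_prod[of "{2, 5, 3}" A] two A5 biunitary_index_4 biunitary_index_25 pos
      by simp
    moreover have "biunitary_index (5 ^ b) \<ge> 6 / 5"
      using biunitary_index_prime_power_ge[of 5 b] b0 ne by (simp add: b_def)
    then have "biunitary_index B \<ge> 3 / 2" using iB by linarith
    ultimately have "biunitary_index A * biunitary_index B \<ge> 13 / 10 * (10 / 9) * (3 / 2)"
      by (intro mult_mono) auto
    then show False using idx by simp
  qed
qed

lemma biunitary_superperfect_even_even:
  assumes N: "N > 0" "even N" and M: "M = biunitary_sigma N" "even M"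
    and eq: "biunitary_sigma M = 2 * N"
  shows False
proof -
  have M0: "M > 0" using biunitary_sigma_ge[OF N(1)] N(1) M(1) by simp
  have idx: "biunitary_index N * biunitary_index M = 2"
    using N(1) M0 M(1) eq by (simp add: biunitary_index_def)
  then have idx': "biunitary_index M * biunitary_index N = 2" by (simp add: mult.commute)
  have NM: "q dvd M" if "q dvd biunitary_sigma N" for q using that M by simp
  have MN: "q dvd N" if "q dvd biunitary_sigma M" "odd q" for q
    using that eq by (metis coprime_dvd_mult_right_iff coprime_right_2_iff_odd)
  \<comment> \<open>If one multiplicity is 2, so is the other; if neither is, both indices are at
    least 3/2. The prime 5 is treated alike below, with 3/2 as 5/4 times 6/5.\<close>
  have two: "multiplicity 2 N = 2 \<and> multiplicity 2 M = 2"
  proof (cases "multiplicity 2 N = 2 \<or> multiplicity 2 M = 2")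
    case True
    then show ?thesis
      using even_superperfect_index_power_of_2[OF N(1) M0 N(2) M(2) idx MN]
        even_superperfect_index_power_of_2[OF M0 N(1) M(2) N(2) idx' NM] by auto
  next
    case False
    have "biunitary_index n \<ge> 3 / 2" if "n > 0" "even n" "multiplicity 2 n \<noteq> 2" for n
    proof -
      have "multiplicity 2 n > 0" using that by (simp add: prime_multiplicity_gt_zero_iff)
      then show ?thesis
        using biunitary_index_prime_power_ge[of 2 "multiplicity 2 n"] that
          biunitary_index_ge_prime_power[OF two_is_prime_nat that(1)] by simp
    qed
    then have "biunitary_index N * biunitary_index M \<ge> 3 / 2 * (3 / 2)"
      using False N M M0 by (intro mult_mono) auto
    then show ?thesis using idx by simp
  qed
  have "5 dvd biunitary_sigma n" if "n > 0" "even n" "multiplicity 2 n = 2" for n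
    using biunitary_sigma_prime_power_dvd[OF that(1) two_is_prime_nat that(2)]
      biunitary_sigma_prime_square[of 2] that(3) by simp
  then have d5: "5 dvd N" "5 dvd M" using NM MN N M M0 two by simp_all
  have five: "multiplicity 5 N = 2 \<and> multiplicity 5 M = 2"
  proof (cases "multiplicity 5 N = 2 \<or> multiplicity 5 M = 2")
    case True
    then show ?thesis
      using even_superperfect_index_power_of_5[OF N(1) M0 d5 idx MN]
        even_superperfect_index_power_of_5[OF M0 N(1) d5(2,1) idx' NM] two by auto
  next
    case False
    have "biunitary_index n \<ge> 3 / 2"
      if "n > 0" "5 dvd n" "multiplicity 5 n \<noteq> 2" "multiplicity 2 n = 2" for n
    proof -
      have "multiplicity 5 n > 0" using that by (simp add: prime_multiplicity_gt_zero_iff)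
      then have "biunitary_index (5 ^ multiplicity 5 n) \<ge> 6 / 5"
        using biunitary_index_prime_power_ge[of 5 "multiplicity 5 n"] that by simp
      then show ?thesis
        using biunitary_index_ge_prod[of "{2, 5}" n] that biunitary_index_4 by simp
    qed
    then have "biunitary_index N * biunitary_index M \<ge> 3 / 2 * (3 / 2)"
      using False two d5 N M M0 by (intro mult_mono) auto
    then show ?thesis using idx by simp
  qed
  have p5: "prime (5 :: nat)" "prime (13 :: nat)" by simp_all
  obtain y where y: "N = 2 ^ 2 * y" "y > 0" "odd y"
      "biunitary_sigma N = biunitary_sigma (2 ^ 2) * biunitary_sigma y"
    using prime_power_split[OF N(1) two_is_prime_nat N(2)] two by metis
  have y5: "multiplicity 5 y = 2"
  proof -
    have "multiplicity 5 N = multiplicity 5 (2 ^ 2 :: nat) + multiplicity 5 y"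
      unfolding y(1) using y(2) by (intro prime_elem_multiplicity_mult_distrib) auto
    then show ?thesis using five by (simp add: not_dvd_imp_multiplicity_0)
  qed
  then have "5 dvd y" by (metis not_dvd_imp_multiplicity_0 zero_neq_numeral)
  obtain x where x: "y = 5 ^ 2 * x" "x > 0" "\<not> 5 dvd x"
      "biunitary_sigma y = biunitary_sigma (5 ^ 2) * biunitary_sigma x"
    using prime_power_split[OF y(2) p5(1) \<open>5 dvd y\<close>] y5 by metis
  have Nx: "N = 100 * x" using x y by simp
  have Mx: "M = 130 * biunitary_sigma x"
    using M x(4) y(4) biunitary_sigma_prime_square[of 2] biunitary_sigma_prime_square[of 5] by simp
  have "odd x" using x(1) y(3) by simp
  \<comment> \<open>From \<open>biunitary_sigma 25 = 26\<close> the prime 13 enters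
    \<open>N\<close>, and hence \<open>x\<close>.\<close>
  have "biunitary_sigma (5 ^ 2) dvd biunitary_sigma M"
    using biunitary_sigma_prime_power_dvd[OF M0 p5(1) d5(2)] five by simp
  then have "2 * 13 dvd biunitary_sigma M" using biunitary_sigma_prime_square[of 5] by simp
  then have "13 dvd N" using MN dvd_mult_right by fastforce
  then have "13 dvd x"
    unfolding Nx using prime_dvd_mult_iff[OF p5(2), of 100 x] by simp
  \<comment> \<open>As \<open>M = 130 * biunitary_sigma x\<close> is divisible by 4 but not by 8,
    \<open>x\<close> is a prime power, hence a power of 13.\<close>
  have not4: "\<not> 4 dvd biunitary_sigma x"
  proof
    assume "4 dvd biunitary_sigma x"
    then have "2 * 4 dvd 130 * biunitary_sigma x" by (intro mult_dvd_mono) auto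
    then have "2 ^ 3 dvd M" using Mx by simp
    then have "multiplicity 2 M \<ge> 3" using M0 by (intro multiplicity_geI) auto
    then show False using two by simp
  qed
  have "x > 1" using \<open>13 dvd x\<close> x(2) by (cases "x = 1") auto
  then obtain p c where pc: "prime p" "c > 0" "x = p ^ c"
    using prime_power_of_not_4_dvd_biunitary_sigma[OF \<open>odd x\<close> _ not4] by blast
  have "13 dvd p" using \<open>13 dvd x\<close> pc p5(2) prime_dvd_power by blast
  then have "p = 13" using pc(1) primes_dvd_imp_eq[OF p5(2)] by simp
  then have "\<not> 13 dvd biunitary_sigma x"
    using not_dvd_biunitary_sigma_prime_power[OF p5(2) pc(2)] pc(3) by simp
  moreover have "biunitary_sigma x > 0" using biunitary_sigma_ge[OF x(2)] x(2) by simp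
  ultimately have "multiplicity 13 M = multiplicity 13 (130 :: nat)"
    unfolding Mx by (subst prime_elem_multiplicity_mult_distrib)
      (auto simp: not_dvd_imp_multiplicity_0)
  also have "\<dots> = 1" by (rule multiplicity_eqI) auto
  finally have m13: "multiplicity 13 M = 1" .
  have "13 dvd M" using Mx by simp
  \<comment> \<open>A single factor 13 in \<open>M\<close> contributes \<open>13 + 1\<close>, but 7
    does not divide \<open>N = 100 * 13 ^ c\<close>.\<close>
  then have "2 * 7 dvd biunitary_sigma M"
    using biunitary_sigma_prime_power_dvd[OF M0 p5(2)] m13 biunitary_sigma_prime[OF p5(2)] by simp
  then have "7 dvd N" using MN dvd_mult_right by fastforce
  then have "7 dvd (13 :: nat) ^ c"
    unfolding Nx using prime_dvd_mult_iff[of 7 100 x] pc \<open>p = 13\<close> by simp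
  then have "7 dvd (13 :: nat)" by (rule prime_dvd_power[rotated]) simp
  then show False by simp
qed

text \<open>An odd prime in \<open>N\<close> would make \<open>M\<close> even, so \<open>N\<close>
  is a power of 2 and \<open>index_power_of_2_dvd_cases\<close> applies with
  \<open>X = M\<close>.\<close>

lemma biunitary_superperfect_even_odd:
  assumes N: "N > 0" "even N" and M: "M = biunitary_sigma N" "odd M"
    and eq: "biunitary_sigma M = 2 * N"
  shows "N = 2"
proof -
  define e where "e = multiplicity 2 N"
  obtain y where y: "N = 2 ^ e * y" "y > 0" "odd y" "e > 0"
      "biunitary_sigma N = biunitary_sigma (2 ^ e) * biunitary_sigma y"
    using prime_power_split[OF N(1) two_is_prime_nat N(2)] unfolding e_def by metis
  have "odd (biunitary_sigma y)" using M y(5) by simp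
  then have "y = 1" using even_biunitary_sigma[OF y(3)] y(2) by fastforce
  then have N2: "N = 2 ^ e" and M2: "M = biunitary_sigma (2 ^ e)" using y M biunitary_sigma_1 by simp_all
  have M0: "M > 0" using biunitary_sigma_ge[OF N(1)] N(1) M(1) by simp
  have le: "biunitary_index (2 ^ e) * biunitary_index M \<le> 2"
    using M M0 N(1) eq N2 by (simp add: biunitary_index_def)
  have "biunitary_sigma (2 ^ e) dvd M" using M2 by simp
  with M(2) y(4) show ?thesis using le
  proof (cases rule: index_power_of_2_dvd_cases)
    case 1
    then show ?thesis using N2 by simp
  next
    case 2
    then have "M = 5" using M2 biunitary_sigma_prime_square[of 2] by simp
    then have "biunitary_sigma M = 6" using biunitary_sigma_prime[of 5] by simp
    then show ?thesis using eq N2 2 by simp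
  next
    case (3 m p r)
    \<comment> \<open>Here \<open>M\<close> is the product of the different primes \<open>p\<close>
      and \<open>r\<close>, so \<open>p\<close> cannot divide it twice.\<close>
    have "multiplicity p M = multiplicity p p + multiplicity p r"
      unfolding M2 3(8) using 3(5,6) prime_gt_0_nat
      by (intro prime_elem_multiplicity_mult_distrib) auto
    moreover have "p < r" using 3(3,4) by (simp add: less_diff_conv)
    then have "\<not> p dvd r" using primes_dvd_imp_eq[OF 3(5,6)] by auto
    ultimately have "multiplicity p M = 1" using 3(5) by (simp add: not_dvd_imp_multiplicity_0)
    then show ?thesis using 3(7) by simp
  qed
qed

theorem theorem1:
  fixes N :: nat
  assumes "N > 0"
  shows "biunitary_sigma (biunitary_sigma N) = 2 * N \<longleftrightarrow> N = 2 \<or> N = 9"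
proof
  assume eq: "biunitary_sigma (biunitary_sigma N) = 2 * N"
  show "N = 2 \<or> N = 9"
  proof (cases "even N")
    case True
    then show ?thesis
      using biunitary_superperfect_even_even[OF assms True refl _ eq]
        biunitary_superperfect_even_odd[OF assms True refl _ eq] by blast
  next
    case False
    then show ?thesis using biunitary_superperfect_odd[OF False eq] by simp
  qed
next
  have s2: "biunitary_sigma 2 = 3" "biunitary_sigma 3 = 4" "biunitary_sigma 5 = 6"
    using biunitary_sigma_prime[of 2] biunitary_sigma_prime[of 3] biunitary_sigma_prime[of 5] by simp_all
  have s9: "biunitary_sigma 9 = 10" using biunitary_sigma_prime_square[of 3] by simp
  have "biunitary_sigma (2 * 5) = 18"
    using biunitary_sigma_mult[of 2 5] s2 by (simp add: coprime_right_2_iff_odd flip: coprime_commute)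
  then show "biunitary_sigma (biunitary_sigma N) = 2 * N" if "N = 2 \<or> N = 9"
    using that s2 s9 by auto
qed

end
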